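(* Consider density estimation on $[0,1]$ with true density $f_0$, a prior $\Pi=\Pi_n$ on probability densities, and $\alpha_n\in(0,1]$ with $n\alpha_n\to\infty$. Let $f\mapsto\psi(f)$ be a functional on probability densities on $[0,1]$ and assume there exists a bounded measurable function $\tilde\psi_{f_0}:[0,1]\to\mathbb R$ such that $$\psi(f)-\psi(f_0)=\int\tilde\psi_{f_0}f+\tilde r(f,f_0)\qquad\text{and}\qquad\int\tilde\psi_{f_0}f_0=0.$$ Suppose that for some sequence $\varepsilon_n\to0$ and measurable sets $A_n\subset\{f:\|f-f_0\|_1\le\varepsilon_n\}$, $$\Pi_{\alpha_n}(A_n\mid Y^n)=1+o_P(1),\qquad\sup_{f\in A_n}|\tilde r(f,f_0)|=o\Big(\frac1{\sqrt{n\alpha_n}}\Big).$$ For $t\in\mathbb R$ denote $f_t=fe^{-t\tilde\psi_{f_0}/\sqrt{n\alpha_n}}\big/\int fe^{-t\tilde\psi_{f_0}/\sqrt{n\alpha_n}}$ and assume that, for every $t\in\mathbb R$, $$\frac{\int_{A_n}e^{\alpha_n\ell_n(f_t)}\,d\Pi(f)}{\int e^{\alpha_n\ell_n(f)}\,d\Pi(f)}=1+o_P(1).$$ Then for $\hat\psi=\psi(f_0)+\frac1n\sum_{i=1}^n\tilde\psi_{f_0}(Y_i)$, the $\alpha_n$-posterior distribution of $\sqrt{n\alpha_n}(\psi(f)-\hat\psi)$ converges weakly in $P_0$-probability to a Gaussian distribution with mean $0$ and variance $\int\tilde\psi_{f_0}^2f_0$.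
   Context: Density estimation: one observes $Y^n=(Y_1,\dots,Y_n)$ i.i.d. from a density $f$ with respect to Lebesgue measure on $[0,1]$; $\ell_n(f)=\sum_{i=1}^n\log f(Y_i)$. $P_0$ is the law of the data under $f_0$; $o_P(1)$ is in $P_0$-probability. The $\alpha_n$-posterior is $\Pi_{\alpha_n}(B\mid Y^n)=\int_Be^{\alpha_n\ell_n}d\Pi/\int e^{\alpha_n\ell_n}d\Pi$. A data-dependent law $Q_Y$ on $\mathbb R$ converges weakly in $P_0$-probability to $\mathcal N(0,V)$ if $d_{BL}(Q_Y,\mathcal N(0,V))\to0$ in $P_0$-probability, with $d_{BL}$ the bounded Lipschitz distance; the $\alpha_n$-posterior distribution of a function of $f$ is the push-forward of $\Pi_{\alpha_n}(\cdot\mid Y^n)$ by that function. *)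

theory Defs
  imports "HOL-Probability.Probability"
begin

definition lebesgue01 :: "real measure" where
  "lebesgue01 = restrict_space lborel {0..1}"

text \<open>Only the values of \<open>f\<close> on the unit interval matter. The requirement that the integral
  equals \<open>1\<close> forces integrability, since the Bochner integral of a non-integrable function is \<open>0\<close>.\<close>

definition prob_density01 :: "(real \<Rightarrow> real) \<Rightarrow> bool" where
  "prob_density01 f \<longleftrightarrow>
     f \<in> borel_measurable lebesgue01 \<and> (\<forall>x\<in>{0..1}. 0 \<le> f x) \<and> (\<integral>x. f x \<partial>lebesgue01) = 1"

definition L1_dist :: "(real \<Rightarrow> real) \<Rightarrow> (real \<Rightarrow> real) \<Rightarrow> real" where
  "L1_dist f g = (\<integral>x. \<bar>f x - g x\<bar> \<partial>lebesgue01)"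

text \<open>A prior is a probability measure on some set of densities, equipped with an arbitrary
  \<open>\<sigma>\<close>-algebra that makes \<open>(f, x) \<mapsto> f x\<close> jointly measurable. Joint measurability is the usual
  condition under which likelihoods can be integrated over the prior and posterior
  probabilities are measurable functions of the data.\<close>

definition density_prior :: "(real \<Rightarrow> real) measure \<Rightarrow> bool" where
  "density_prior Pri \<longleftrightarrow>
     prob_space Pri \<and> (\<forall>f\<in>space Pri. prob_density01 f) \<and>
     (\<lambda>(f, x). f x) \<in> borel_measurable (Pri \<Otimes>\<^sub>M lebesgue01)"

text \<open>The law of \<open>n\<close> i.i.d. observations from \<open>f\<close>; the sample is indexed by \<open>0, \<dots>, n - 1\<close>.\<close>

definition sample_law :: "(real \<Rightarrow> real) \<Rightarrow> nat \<Rightarrow> (nat \<Rightarrow> real) measure" where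
  "sample_law f n = (\<Pi>\<^sub>M i\<in>{..<n}. density lebesgue01 (\<lambda>x. ennreal (f x)))"

text \<open>A density may vanish at an observation, so the log-likelihood takes values in
  \<open>[-\<infinity>, \<infinity>)\<close>, with \<open>log 0 = -\<infinity>\<close> and \<open>e\<^sup>-\<^sup>\<infinity> = 0\<close> (whereas \<open>ln 0 = 0\<close> on type \<open>real\<close>). The value of
  \<open>eexp\<close> at \<open>\<infinity>\<close> is irrelevant.\<close>

definition elog :: "real \<Rightarrow> ereal" where
  "elog x = (if x \<le> 0 then -\<infinity> else ereal (ln x))"

definition eexp :: "ereal \<Rightarrow> real" where
  "eexp x = (if \<bar>x\<bar> = \<infinity> then 0 else exp (real_of_ereal x))"

definition log_lik :: "nat \<Rightarrow> (nat \<Rightarrow> real) \<Rightarrow> (real \<Rightarrow> real) \<Rightarrow> ereal" where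
  "log_lik n y f = (\<Sum>i<n. elog (f (y i)))"

definition frac_lik :: "real \<Rightarrow> nat \<Rightarrow> (nat \<Rightarrow> real) \<Rightarrow> (real \<Rightarrow> real) \<Rightarrow> real" where
  "frac_lik \<alpha> n y f = eexp (ereal \<alpha> * log_lik n y f)"

lemma frac_lik_eq_prod:
  assumes "0 < \<alpha>" and "\<And>i. i < n \<Longrightarrow> 0 \<le> f (y i)"
  shows "frac_lik \<alpha> n y f = (\<Prod>i<n. f (y i) powr \<alpha>)"
proof (cases "\<forall>i<n. 0 < f (y i)")
  case True
  have "log_lik n y f = (\<Sum>i<n. ereal (ln (f (y i))))"
    unfolding log_lik_def by (rule sum.cong) (use True in \<open>auto simp: elog_def not_le\<close>)
  then have "log_lik n y f = ereal (\<Sum>i<n. ln (f (y i)))"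
    by simp
  then have "frac_lik \<alpha> n y f = exp (\<Sum>i<n. \<alpha> * ln (f (y i)))"
    by (simp add: frac_lik_def eexp_def sum_distrib_left)
  also have "\<dots> = (\<Prod>i<n. exp (\<alpha> * ln (f (y i))))"
    by (simp add: exp_sum)
  also have "\<dots> = (\<Prod>i<n. f (y i) powr \<alpha>)"
    by (rule prod.cong) (use True in \<open>auto simp: powr_def\<close>)
  finally show ?thesis .
next
  case False
  then obtain j where j: "j < n" "f (y j) = 0"
    using assms(2) by (metis less_eq_real_def)
  have "(\<Sum>i\<in>{..<n} - {j}. elog (f (y i))) \<noteq> \<infinity>"
    by (subst sum_Pinfty) (auto simp: elog_def)
  moreover have "log_lik n y f = elog (f (y j)) + (\<Sum>i\<in>{..<n} - {j}. elog (f (y i)))"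
    unfolding log_lik_def by (rule sum.remove) (use j in auto)
  ultimately have "log_lik n y f = -\<infinity>"
    using j by (simp add: elog_def)
  then have "frac_lik \<alpha> n y f = 0"
    using assms(1) by (simp add: frac_lik_def eexp_def)
  moreover have "(\<Prod>i<n. f (y i) powr \<alpha>) = 0"
    by (rule prod_zero) (use j in auto)
  ultimately show ?thesis by simp
qed

text \<open>The \<open>\<alpha>\<close>-posterior, as a measure on densities. On the \<open>P\<^sub>0\<close>-null set of data where the
  normalising integral is infinite, and where it is \<open>0\<close>, this is the zero measure.\<close>

definition frac_posterior ::
    "(real \<Rightarrow> real) measure \<Rightarrow> real \<Rightarrow> nat \<Rightarrow> (nat \<Rightarrow> real) \<Rightarrow> (real \<Rightarrow> real) measure" where
  "frac_posterior Pri \<alpha> n y =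
     density Pri (\<lambda>f. ennreal (frac_lik \<alpha> n y f / (\<integral>g. frac_lik \<alpha> n y g \<partial>Pri)))"

lemma measure_frac_posterior:
  assumes [measurable]: "frac_lik \<alpha> n y \<in> borel_measurable Pri" "B \<in> sets Pri"
  shows "measure (frac_posterior Pri \<alpha> n y) B =
           (LINT f:B|Pri. frac_lik \<alpha> n y f) / (\<integral>f. frac_lik \<alpha> n y f \<partial>Pri)"
proof -
  let ?D = "\<integral>g. frac_lik \<alpha> n y g \<partial>Pri"
  have nonneg: "0 \<le> frac_lik \<alpha> n y f" for f
    by (simp add: frac_lik_def eexp_def)
  then have D: "0 \<le> ?D" by simp
  have "emeasure (frac_posterior Pri \<alpha> n y) B
      = (\<integral>\<^sup>+f. ennreal (indicator B f * (frac_lik \<alpha> n y f / ?D)) \<partial>Pri)"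
    unfolding frac_posterior_def
    by (subst emeasure_density) (auto intro!: nn_integral_cong split: split_indicator)
  then have "measure (frac_posterior Pri \<alpha> n y) B
      = (\<integral>f. indicator B f * (frac_lik \<alpha> n y f / ?D) \<partial>Pri)"
    unfolding measure_def
    by (subst integral_eq_nn_integral) (use nonneg D in auto)
  also have "\<dots> = (\<integral>f. (indicator B f * frac_lik \<alpha> n y f) / ?D \<partial>Pri)"
    by simp
  also have "\<dots> = (LINT f:B|Pri. frac_lik \<alpha> n y f) / ?D"
    unfolding set_lebesgue_integral_def by (subst integral_divide_zero) simp
  finally show ?thesis .
qed

text \<open>With \<open>c = t / \<surd>(n \<alpha>\<^sub>n)\<close> and \<open>h\<close> the influence function this is the density \<open>f\<^sub>t\<close>.\<close>

definition exp_tilt :: "(real \<Rightarrow> real) \<Rightarrow> real \<Rightarrow> (real \<Rightarrow> real) \<Rightarrow> real \<Rightarrow> real" where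
  "exp_tilt h c f = (\<lambda>x. f x * exp (- c * h x) / (\<integral>u. f u * exp (- c * h u) \<partial>lebesgue01))"

text \<open>Convergence in probability to a constant, along a sequence of probability spaces. For
  measurable \<open>X n\<close> this is the usual notion. The events \<open>E n\<close> make it convergence in outer
  probability in general: \<open>measure\<close> returns \<open>0\<close> on non-measurable sets, so the naive definition
  would hold vacuously for non-measurable \<open>X n\<close>.\<close>

definition tendsto_in_prob :: "(nat \<Rightarrow> 'a measure) \<Rightarrow> (nat \<Rightarrow> 'a \<Rightarrow> real) \<Rightarrow> real \<Rightarrow> bool" where
  "tendsto_in_prob P X c \<longleftrightarrow>
     (\<forall>e>0. \<exists>E. (\<forall>n. E n \<in> sets (P n) \<and> {w \<in> space (P n). e < \<bar>X n w - c\<bar>} \<subseteq> E n) \<and>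
                (\<lambda>n. measure (P n) (E n)) \<longlonglongrightarrow> 0)"

definition BL_dist :: "real measure \<Rightarrow> real measure \<Rightarrow> real" where
  "BL_dist Q R =
     (SUP h\<in>{h :: real \<Rightarrow> real. (\<forall>x. \<bar>h x\<bar> \<le> 1) \<and> 1-lipschitz_on UNIV h}.
        \<bar>(\<integral>x. h x \<partial>Q) - (\<integral>x. h x \<partial>R)\<bar>)"

text \<open>The second argument is the variance; the case of variance \<open>0\<close> is the point mass (there,
  \<open>normal_density\<close> is identically \<open>0\<close>).\<close>

definition gaussian :: "real \<Rightarrow> real \<Rightarrow> real measure" where
  "gaussian m V =
     (if V = 0 then return borel m else density lborel (\<lambda>x. ennreal (normal_density m (sqrt V) x)))"

definition weakly_in_prob ::
    "(nat \<Rightarrow> 'a measure) \<Rightarrow> (nat \<Rightarrow> 'a \<Rightarrow> real measure) \<Rightarrow> real measure \<Rightarrow> bool" where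
  "weakly_in_prob P Q R \<longleftrightarrow> tendsto_in_prob P (\<lambda>n w. BL_dist (Q n w) R) 0"

end

theory Submission
  imports Defs "HOL-Complex_Analysis.Complex_Analysis"
begin

text \<open>Restrict the \<open>\<alpha>\<close>-posterior to \<open>A\<^sub>n\<close>. A second-order expansion of the mass of the tilted
  density gives
  \<open>\<alpha>\<^sub>n \<ell>\<^sub>n(f\<^sub>t) = \<alpha>\<^sub>n \<ell>\<^sub>n(f) + t \<surd>(n \<alpha>\<^sub>n) (\<psi>(f) - \<psi>') - t\<^sup>2 V / 2 + o(1)\<close> uniformly on \<open>A\<^sub>n\<close>, where
  \<open>\<psi>'\<close> is the centring and \<open>V\<close> the variance, so the change of measure condition says that the
  Laplace transform of the restricted posterior tends in probability to \<open>exp (t\<^sup>2 V / 2)\<close>. A normal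
  families argument for Laplace transforms on a strip shows that a law whose Laplace transform is
  close to the Gaussian one at finitely many points is close to the Gaussian law in bounded
  Lipschitz distance.\<close>

text \<open>The change of measure condition holds for each \<open>t\<close> separately, with
  exceptional events that depend on \<open>t\<close>, and samples of different sizes live on
  unrelated spaces. Only finitely many \<open>t\<close> can be controlled on one event of
  probability near 1, so the analytic part has to end in a criterion with a finite set of points and
  one tolerance. Compactness supplies it: the points 1 and -1 bound the exponential moments, and
  with them the transforms on the whole strip, while the other points serve to identify the limit.

  The tilt has size \<open>t / sqrt (n * \<alpha> n)\<close>, so that multiplying the log mass by
  \<open>n * \<alpha> n\<close> keeps the second-order term and leaves a third-order term of order
  \<open>1 / sqrt (n * \<alpha> n)\<close>. The logarithm also produces the square of the linear
  term. Centring makes the mean of the influence function under \<open>f\<close> at most a multiple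
  of \<open>\<epsilon> n\<close>, so this square disappears in the limit; closeness in L1 replaces
  the second moment under \<open>f\<close> by the one under \<open>f0\<close>.\<close>

section \<open>Laplace transforms on the strip of half-width 1\<close>

text \<open>Used with \<open>a = Re z\<close> and \<open>b = norm (w - z)\<close>: the condition
  keeps the disc of radius \<open>b\<close> around \<open>z\<close> inside the closed strip, and the
  right-hand side is an integrable majorant that depends on neither point.\<close>

lemma exp_times_le_cosh_bound:
  fixes a b x :: real
  assumes "\<bar>a\<bar> + b \<le> 1" "0 \<le> b"
  shows "exp (a * x) * exp (b * \<bar>x\<bar>) \<le> exp x + exp (- x)"
proof -
  have "a * x + b * \<bar>x\<bar> \<le> \<bar>a\<bar> * \<bar>x\<bar> + b * \<bar>x\<bar>"
    by (metis abs_ge_self abs_mult add_right_mono)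
  also have "\<dots> = (\<bar>a\<bar> + b) * \<bar>x\<bar>"
    by (simp add: algebra_simps)
  also have "\<dots> \<le> \<bar>x\<bar>"
    using assms by (intro mult_left_le_one_le) auto
  finally have "exp (a * x) * exp (b * \<bar>x\<bar>) \<le> exp \<bar>x\<bar>"
    by (simp add: mult_exp_exp)
  also have "\<dots> \<le> exp x + exp (- x)"
    by (auto simp: abs_if less_eq_real_def add_pos_pos)
  finally show ?thesis .
qed

text \<open>Around each \<open>z\<close> the exponential series is integrated term by term on the
  largest disc inside the strip. Its partial sums are dominated by \<open>exp x + exp (- x)\<close>,
  so dominated convergence yields a local power series.\<close>

lemma laplace_transform_holomorphic:
  fixes M :: "real measure"
  assumes M [measurable_cong]: "sets M = sets borel"
    and int: "integrable M exp" "integrable M (\<lambda>x. exp (- x))"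
  shows "(\<lambda>z. \<integral>x. exp (z * complex_of_real x) \<partial>M) holomorphic_on {z. \<bar>Re z\<bar> < 1}"
proof -
  define F where "F = (\<lambda>z. \<integral>x. exp (z * complex_of_real x) \<partial>M)"
  have bound_int: "integrable M (\<lambda>x. exp x + exp (- x))"
    using int by simp
  have local: "F holomorphic_on ball z (1 - \<bar>Re z\<bar>)" if z: "\<bar>Re z\<bar> < 1" for z
  proof (rule power_series_holomorphic)
    fix w assume "w \<in> ball z (1 - \<bar>Re z\<bar>)"
    then have w: "\<bar>Re z\<bar> + norm (w - z) \<le> 1"
      by (simp add: dist_norm norm_minus_commute)
    define f where "f = (\<lambda>i x. exp (z * complex_of_real x) * complex_of_real x ^ i /\<^sub>R fact i * (w - z) ^ i)"
    have f_eq: "f i x = exp (z * complex_of_real x) * (((w - z) * complex_of_real x) ^ i /\<^sub>R fact i)" for i x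
      by (simp add: f_def power_mult_distrib)
    have norm_sum: "norm (\<Sum>i\<in>I. f i x) \<le> exp x + exp (- x)" if "finite I" for I x
    proof -
      have "norm (\<Sum>i\<in>I. f i x)
          \<le> (\<Sum>i\<in>I. exp (Re z * x) * ((norm (w - z) * \<bar>x\<bar>) ^ i /\<^sub>R fact i))"
        by (rule sum_norm_le) (simp add: f_eq norm_mult norm_power divide_inverse)
      also have "\<dots> = exp (Re z * x) * (\<Sum>i\<in>I. (norm (w - z) * \<bar>x\<bar>) ^ i /\<^sub>R fact i)"
        by (simp add: sum_distrib_left)
      also have "\<dots> \<le> exp (Re z * x) * exp (norm (w - z) * \<bar>x\<bar>)"
        using sum_le_suminf[OF summable_exp_generic that, of "norm (w - z) * \<bar>x\<bar>"]
        by (intro mult_left_mono exp_ge_zero) (simp add: exp_def)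
      also have "\<dots> \<le> exp x + exp (- x)"
        by (rule exp_times_le_cosh_bound) (use w in auto)
      finally show ?thesis .
    qed
    have f_meas [measurable]: "f i \<in> borel_measurable M" for i
      unfolding f_def by measurable
    have f_int: "integrable M (f i)" for i
      by (rule Bochner_Integration.integrable_bound[OF bound_int])
        (use norm_sum[of "{i}"] in \<open>auto intro!: AE_I2 order_trans[OF _ abs_ge_self]\<close>)
    have "(\<lambda>n. \<integral>x. (\<Sum>i<n. f i x) \<partial>M) \<longlonglongrightarrow> F w"
      unfolding F_def
    proof (rule integral_dominated_convergence)
      show "AE x in M. (\<lambda>n. \<Sum>i<n. f i x) \<longlonglongrightarrow> exp (w * complex_of_real x)"
      proof (rule AE_I2)
        fix x
        have "(\<lambda>i. f i x) sums (exp (z * complex_of_real x) * exp ((w - z) * complex_of_real x))"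
          unfolding f_eq by (intro sums_mult exp_converges)
        then show "(\<lambda>n. \<Sum>i<n. f i x) \<longlonglongrightarrow> exp (w * complex_of_real x)"
          by (simp add: sums_def mult_exp_exp algebra_simps)
      qed
      show "AE x in M. norm (\<Sum>i<n. f i x) \<le> exp x + exp (- x)" for n
        by (simp add: norm_sum)
    qed (use bound_int in auto)
    moreover have "(\<integral>x. (\<Sum>i<n. f i x) \<partial>M)
        = (\<Sum>i<n. (\<integral>x. exp (z * complex_of_real x) * complex_of_real x ^ i /\<^sub>R fact i \<partial>M) * (w - z) ^ i)" for n
    proof -
      have "(\<integral>x. (\<Sum>i<n. f i x) \<partial>M) = (\<Sum>i<n. \<integral>x. f i x \<partial>M)"
        using f_int by (rule Bochner_Integration.integral_sum)
      then show ?thesis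
        by (simp add: f_def)
    qed
    ultimately show "(\<lambda>i. (\<integral>x. exp (z * complex_of_real x) * complex_of_real x ^ i /\<^sub>R fact i \<partial>M)
        * (w - z) ^ i) sums F w"
      by (simp add: sums_def)
  qed
  have op: "open {z. \<bar>Re z\<bar> < 1}"
    by (intro open_Collect_less continuous_intros)
  have "F field_differentiable at z" if "\<bar>Re z\<bar> < 1" for z
    using local[OF that] that
    by (metis centre_in_ball diff_gt_0_iff_gt holomorphic_on_imp_differentiable_at open_ball)
  then show ?thesis
    unfolding F_def[symmetric] using op by (simp add: holomorphic_on_open field_differentiable_def)
qed

text \<open>Control at the two real points 1 and -1 becomes a bound on the whole strip, as Montel's
  theorem requires.\<close>

lemma laplace_transform_norm_le:
  fixes M :: "real measure"
  assumes "sets M = sets borel" "integrable M exp" "integrable M (\<lambda>x. exp (- x))" "\<bar>Re z\<bar> \<le> 1"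
  shows "norm (\<integral>x. exp (z * complex_of_real x) \<partial>M) \<le> (\<integral>x. exp x \<partial>M) + (\<integral>x. exp (- x) \<partial>M)"
proof -
  have [measurable_cong]: "sets M = sets borel" by fact
  have *: "norm (exp (z * complex_of_real x)) \<le> exp x + exp (- x)" for x
    using exp_times_le_cosh_bound[of "Re z" 0 x] assms by simp
  have int: "integrable M (\<lambda>x. exp x + exp (- x))"
    using assms by simp
  have "norm (\<integral>x. exp (z * complex_of_real x) \<partial>M) \<le> (\<integral>x. exp x + exp (- x) \<partial>M)"
    by (rule Bochner_Integration.integral_norm_bound_integral[OF Bochner_Integration.integrable_bound[OF int] int])
      (use * in \<open>auto intro!: AE_I2 order_trans[OF _ abs_ge_self]\<close>)
  then show ?thesis
    using assms by simp
qed

section \<open>Gaussian laws and convergence towards them\<close>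

text \<open>Scaling a standard normal variable covers variance 0 and positive variance alike, so the
  characteristic function needs no case distinction.\<close>

lemma gaussian_eq_distr:
  assumes "0 \<le> V"
  shows "gaussian 0 V = distr std_normal_distribution borel (\<lambda>x. sqrt V * x)"
proof (cases "V = 0")
  case True
  interpret real_distribution std_normal_distribution by (rule real_dist_normal_dist)
  show ?thesis using True by (simp add: gaussian_def)
next
  case False
  interpret prob_space std_normal_distribution
    using real_dist_normal_dist by (simp add: real_distribution_def)
  have "distributed std_normal_distribution lborel (\<lambda>x. x) std_normal_density"
    by (auto simp: distributed_def emeasure_distr intro!: measure_eqI)
  then have "distributed std_normal_distribution lborel (\<lambda>x. 0 + sqrt V * x)
      (normal_density (0 + sqrt V * 0) (\<bar>sqrt V\<bar> * 1))"
    using False by (intro normal_density_affine) auto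
  then have "distr std_normal_distribution lborel (\<lambda>x. sqrt V * x)
      = density lborel (\<lambda>x. ennreal (normal_density 0 (sqrt V) x))"
    using assms by (simp add: distributed_def)
  moreover have "distr std_normal_distribution lborel (\<lambda>x. sqrt V * x)
      = distr std_normal_distribution borel (\<lambda>x. sqrt V * x)"
    by (rule distr_cong) auto
  ultimately show ?thesis
    using False by (simp add: gaussian_def)
qed

lemma real_distribution_gaussian: "0 \<le> V \<Longrightarrow> real_distribution (gaussian 0 V)"
  using real_dist_normal_dist
  by (auto simp: gaussian_eq_distr real_distribution_def real_distribution_axioms_def
      intro!: prob_space.prob_space_distr)

lemma char_gaussian:
  assumes "0 \<le> V"
  shows "char (gaussian 0 V) s = complex_of_real (exp (- (V * s\<^sup>2) / 2))"
proof -
  have "char (gaussian 0 V) s = char std_normal_distribution (s * sqrt V)"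
    unfolding char_def using assms
    by (simp add: gaussian_eq_distr integral_distr mult.assoc)
  then show ?thesis
    using assms by (simp add: char_std_normal_distribution power_mult_distrib mult.commute)
qed

text \<open>On the strip \<open>\<bar>Re z\<bar> < 1\<close> the Laplace transforms form a normal family. The prescribed limits
  at the points \<open>1 / (j + 2)\<close>, which accumulate at \<open>0\<close>, identify every limit function, and on the
  imaginary axis the limit is the characteristic function of the Gaussian law.\<close>

lemma weak_conv_gaussian_subseq:
  fixes \<mu> :: "nat \<Rightarrow> real measure"
  assumes dist: "\<And>k. real_distribution (\<mu> k)"
    and int: "\<And>k. integrable (\<mu> k) exp" "\<And>k. integrable (\<mu> k) (\<lambda>x. exp (- x))"
    and bound: "\<And>k. (\<integral>x. exp x \<partial>\<mu> k) + (\<integral>x. exp (- x) \<partial>\<mu> k) \<le> B"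
    and lim: "\<And>j. (\<lambda>k. \<integral>x. exp (1 / (real j + 2) * x) \<partial>\<mu> k) \<longlonglongrightarrow> exp ((1 / (real j + 2))\<^sup>2 * V / 2)"
    and V: "0 \<le> V"
  obtains \<rho> :: "nat \<Rightarrow> nat" where "strict_mono \<rho>" "weak_conv_m (\<lambda>k. \<mu> (\<rho> k)) (gaussian 0 V)"
proof -
  let ?S = "{z. \<bar>Re z\<bar> < 1}"
  define F where "F = (\<lambda>k z. \<integral>x. exp (z * complex_of_real x) \<partial>\<mu> k)"
  have sets [simp]: "sets (\<mu> k) = sets borel" for k
    using dist[of k] by (simp add: real_distribution.events_eq_borel)
  have op: "open ?S"
    by (intro open_Collect_less continuous_intros)
  have conn: "connected ?S"
  proof -
    have "?S = Re -` {-1<..<1}"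
      by (auto simp: abs_less_iff)
    also have "convex \<dots>"
      by (intro convex_linear_vimage convex_real_interval) (simp add: bounded_linear.linear bounded_linear_Re)
    finally show ?thesis
      by (rule convex_connected)
  qed
  have hol: "F k holomorphic_on ?S" for k
    unfolding F_def by (rule laplace_transform_holomorphic) (simp_all add: int)
  have F_le: "norm (F k z) \<le> B" if "z \<in> ?S" for k z
    unfolding F_def using that by (intro order_trans[OF laplace_transform_norm_le bound]) (simp_all add: int)
  obtain g \<rho> where g: "g holomorphic_on ?S" and \<rho>: "strict_mono (\<rho> :: nat \<Rightarrow> nat)"
    and conv: "\<And>z. z \<in> ?S \<Longrightarrow> (\<lambda>n. F (\<rho> n) z) \<longlonglongrightarrow> g z"
  proof (rule Montel[OF op, of "range F" F])
    show "\<exists>B. \<forall>h\<in>range F. \<forall>z\<in>K. norm (h z) \<le> B" if "K \<subseteq> ?S" for K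
      using F_le that by blast
  qed (use hol in auto)
  define G where "G = (\<lambda>z :: complex. exp (z\<^sup>2 * complex_of_real V / 2))"
  \<comment> \<open>The shift by 2 keeps every point strictly inside the open strip; a shift by 1
    would put the first one on its boundary.\<close>
  define p where "p = (\<lambda>j. complex_of_real (1 / (real j + 2)))"
  have p_in: "p j \<in> ?S" for j
    by (auto simp: p_def)
  have p_eq: "g (p j) = G (p j)" for j
  proof (rule LIMSEQ_unique[OF conv[OF p_in]])
    have "F k (p j) = complex_of_real (\<integral>x. exp (1 / (real j + 2) * x) \<partial>\<mu> k)" for k
      unfolding F_def p_def integral_complex_of_real[symmetric]
      by (simp only: of_real_mult[symmetric] exp_of_real)
    moreover have "G (p j) = complex_of_real (exp ((1 / (real j + 2))\<^sup>2 * V / 2))"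
      unfolding G_def p_def exp_of_real[symmetric] by simp
    ultimately show "(\<lambda>n. F (\<rho> n) (p j)) \<longlonglongrightarrow> G (p j)"
      using LIMSEQ_subseq_LIMSEQ[OF lim[of j] \<rho>] by (simp add: comp_def tendsto_of_real_iff)
  qed
  have islimpt: "0 islimpt range p"
  proof -
    have "(\<lambda>j. 1 / (real j + 2)) \<longlonglongrightarrow> 0"
      by real_asymp
    then have "p \<longlonglongrightarrow> of_real 0"
      unfolding p_def by (rule tendsto_of_real)
    moreover have "p j \<in> range p - {0}" for j
      unfolding p_def of_real_eq_0_iff by (simp del: of_real_divide add: add_nonneg_eq_0_iff)
    ultimately show ?thesis
      unfolding islimpt_sequential of_real_0 by blast
  qed
  have eq: "g z = G z" if "z \<in> ?S" for z
  proof -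
    have "g z - G z = 0"
      by (rule analytic_continuation[of "\<lambda>z. g z - G z" ?S "range p" 0])
        (use g op conn p_in p_eq islimpt that in \<open>auto simp: G_def intro!: holomorphic_intros\<close>)
    then show ?thesis by simp
  qed
  have "(\<lambda>n. char (\<mu> (\<rho> n)) s) \<longlonglongrightarrow> char (gaussian 0 V) s" for s
  proof -
    have "(\<lambda>n. F (\<rho> n) (\<i> * complex_of_real s)) \<longlonglongrightarrow> G (\<i> * complex_of_real s)"
      using conv[of "\<i> * complex_of_real s"] eq[of "\<i> * complex_of_real s"] by simp
    moreover have "G (\<i> * complex_of_real s) = char (gaussian 0 V) s"
      unfolding G_def char_gaussian[OF V] exp_of_real[symmetric]
      by (simp add: power_mult_distrib mult.commute)
    ultimately show ?thesis
      by (simp add: F_def char_def mult.assoc)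
  qed
  then have "weak_conv_m (\<lambda>k. \<mu> (\<rho> k)) (gaussian 0 V)"
    by (intro levy_continuity dist real_distribution_gaussian V)
  then show thesis
    using \<rho> that by blast
qed

section \<open>Bounded Lipschitz test functions and the finite Laplace criterion\<close>

text \<open>The class over which \<open>BL_dist\<close> takes its supremum. Estimates are stated for
  each member, and \<open>BL_dist_le\<close> turns them into a bound on the supremum.\<close>

definition BL_functions :: "(real \<Rightarrow> real) set" where
  "BL_functions = {h. (\<forall>x. \<bar>h x\<bar> \<le> 1) \<and> 1-lipschitz_on UNIV h}"

lemma BL_functions_bounded: "h \<in> BL_functions \<Longrightarrow> \<bar>h x\<bar> \<le> 1"
  by (simp add: BL_functions_def)

lemma BL_functions_measurable [measurable]: "h \<in> BL_functions \<Longrightarrow> h \<in> borel_measurable borel"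
  by (auto simp: BL_functions_def intro!: borel_measurable_continuous_onI lipschitz_on_continuous_on)

text \<open>The bound does not involve \<open>h\<close>, which gives uniformity over the class, and
  the cap 2 makes it a dominated quantity without any moment condition.\<close>

lemma BL_functions_diff_le: "h \<in> BL_functions \<Longrightarrow> \<bar>h x - h y\<bar> \<le> min 2 \<bar>x - y\<bar>"
proof -
  assume h: "h \<in> BL_functions"
  then have "\<bar>h x - h y\<bar> \<le> \<bar>x - y\<bar>"
    using lipschitz_onD[of 1 UNIV h x y] by (simp add: BL_functions_def dist_real_def)
  then show ?thesis
    using BL_functions_bounded[OF h, of x] BL_functions_bounded[OF h, of y] by auto
qed

text \<open>A Skorohod coupling bounds the differences for all test functions at once.\<close>

lemma weak_conv_uniform_BL:
  fixes \<mu> :: "nat \<Rightarrow> real measure"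
  assumes dist: "\<And>n. real_distribution (\<mu> n)" "real_distribution M"
    and weak: "weak_conv_m \<mu> M" and e: "0 < e"
  shows "\<forall>\<^sub>F n in sequentially. \<forall>h\<in>BL_functions. \<bar>(\<integral>x. h x \<partial>\<mu> n) - (\<integral>x. h x \<partial>M)\<bar> \<le> e"
proof -
  obtain \<Omega> :: "real measure" and Y Z where "prob_space \<Omega>"
    and Y [measurable]: "\<And>n. Y n \<in> borel_measurable \<Omega>" and dY: "\<And>n. distr \<Omega> borel (Y n) = \<mu> n"
    and "Z \<in> measurable \<Omega> lborel" and dZ: "distr \<Omega> borel Z = M"
    and YZ: "\<And>x. x \<in> space \<Omega> \<Longrightarrow> (\<lambda>n. Y n x) \<longlonglongrightarrow> Z x"
    using Skorohod[OF dist weak] by blast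
  interpret prob_space \<Omega> by fact
  have Z [measurable]: "Z \<in> borel_measurable \<Omega>"
    using \<open>Z \<in> measurable \<Omega> lborel\<close> by simp
  define m where "m = (\<lambda>n x. min 2 \<bar>Y n x - Z x\<bar>)"
  have m_int: "integrable \<Omega> (m n)" for n
    unfolding m_def by (rule integrable_const_bound[of _ 2]) auto
  have "(\<lambda>n. \<integral>x. m n x \<partial>\<Omega>) \<longlonglongrightarrow> (\<integral>x. 0 \<partial>\<Omega>)"
  proof (rule integral_dominated_convergence[where w = "\<lambda>_. 2"])
    show "AE x in \<Omega>. (\<lambda>n. m n x) \<longlonglongrightarrow> 0"
    proof (rule AE_I2)
      fix x assume "x \<in> space \<Omega>"
      then have "(\<lambda>n. min 2 \<bar>Y n x - Z x\<bar>) \<longlonglongrightarrow> min 2 \<bar>Z x - Z x\<bar>"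
        by (intro tendsto_intros YZ)
      then show "(\<lambda>n. m n x) \<longlonglongrightarrow> 0"
        by (simp add: m_def)
    qed
  qed (auto simp: m_def)
  then have "\<forall>\<^sub>F n in sequentially. (\<integral>x. m n x \<partial>\<Omega>) < e"
    using e by (simp add: order_tendstoD)
  then show ?thesis
  proof (rule eventually_mono, intro ballI)
    fix n h assume n: "(\<integral>x. m n x \<partial>\<Omega>) < e" and h: "h \<in> BL_functions"
    note [measurable] = BL_functions_measurable[OF h]
    have int: "integrable \<Omega> (\<lambda>x. h (X x))" if [measurable]: "X \<in> borel_measurable \<Omega>" for X
      by (rule integrable_const_bound[of _ 1]) (use BL_functions_bounded[OF h] in auto)
    have "(\<integral>x. h x \<partial>\<mu> n) - (\<integral>x. h x \<partial>M) = (\<integral>x. h (Y n x) - h (Z x) \<partial>\<Omega>)"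
      by (simp add: integral_distr int flip: dY dZ)
    also have "\<bar>\<dots>\<bar> \<le> (\<integral>x. m n x \<partial>\<Omega>)"
    proof (rule integral_abs_bound_integral)
      show "\<bar>h (Y n x) - h (Z x)\<bar> \<le> m n x" for x
        using BL_functions_diff_le[OF h] by (simp add: m_def)
    qed (simp_all add: int m_int)
    finally show "\<bar>(\<integral>x. h x \<partial>\<mu> n) - (\<integral>x. h x \<partial>M)\<bar> \<le> e"
      using n by simp
  qed
qed

text \<open>Being a statement about single measures, this transfers to random measures on varying
  probability spaces, where no almost surely convergent subsequence is available.\<close>

lemma laplace_close_imp_BL_close:
  assumes V: "0 \<le> V" and e: "0 < e"
  shows "\<exists>T \<delta>. finite T \<and> 0 < \<delta> \<and>
    (\<forall>\<mu>. real_distribution \<mu> \<longrightarrow>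
      (\<forall>t\<in>T. integrable \<mu> (\<lambda>x. exp (t * x)) \<and> \<bar>(\<integral>x. exp (t * x) \<partial>\<mu>) - exp (t\<^sup>2 * V / 2)\<bar> \<le> \<delta>) \<longrightarrow>
      (\<forall>h\<in>BL_functions. \<bar>(\<integral>x. h x \<partial>\<mu>) - (\<integral>x. h x \<partial>gaussian 0 V)\<bar> \<le> e))"
proof (rule ccontr)
  assume neg: "\<not> ?thesis"
  \<comment> \<open>The points 1 and -1 give the moment bound. A fixed point
    \<open>1 / (j + 2)\<close> belongs to \<open>T k\<close> once \<open>k\<close> is at least
    \<open>j\<close>, so the counterexamples, with tolerance \<open>1 / (k + 1)\<close>, converge at
    every such point.\<close>
  define T where "T = (\<lambda>k. {1, -1} \<union> (\<lambda>j. 1 / (real j + 2)) ` {..k::nat})"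
  have "\<exists>\<mu>. real_distribution \<mu> \<and>
      (\<forall>t\<in>T k. integrable \<mu> (\<lambda>x. exp (t * x)) \<and>
        \<bar>(\<integral>x. exp (t * x) \<partial>\<mu>) - exp (t\<^sup>2 * V / 2)\<bar> \<le> 1 / (real k + 1)) \<and>
      (\<exists>h\<in>BL_functions. e < \<bar>(\<integral>x. h x \<partial>\<mu>) - (\<integral>x. h x \<partial>gaussian 0 V)\<bar>)" for k
  proof -
    have "finite (T k)" "0 < 1 / (real k + 1)"
      by (auto simp: T_def)
    then show ?thesis
      using neg unfolding not_ex by (meson not_le)
  qed
  then obtain \<mu> where dist: "\<And>k. real_distribution (\<mu> k)"
    and lap: "\<And>k t. t \<in> T k \<Longrightarrow> integrable (\<mu> k) (\<lambda>x. exp (t * x))"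
      "\<And>k t. t \<in> T k \<Longrightarrow> \<bar>(\<integral>x. exp (t * x) \<partial>\<mu> k) - exp (t\<^sup>2 * V / 2)\<bar> \<le> 1 / (real k + 1)"
    and far: "\<And>k. \<exists>h\<in>BL_functions. e < \<bar>(\<integral>x. h x \<partial>\<mu> k) - (\<integral>x. h x \<partial>gaussian 0 V)\<bar>"
    by metis
  have "(\<lambda>k. \<integral>x. exp (1 / (real j + 2) * x) \<partial>\<mu> k) \<longlonglongrightarrow> exp ((1 / (real j + 2))\<^sup>2 * V / 2)" for j
  proof (rule LIM_zero_cancel, rule Lim_null_comparison)
    show "\<forall>\<^sub>F k in sequentially. norm ((\<integral>x. exp (1 / (real j + 2) * x) \<partial>\<mu> k)
        - exp ((1 / (real j + 2))\<^sup>2 * V / 2)) \<le> 1 / (real k + 1)"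
      using eventually_ge_at_top[of j] by eventually_elim (use lap(2)[of "1 / (real j + 2)"] in \<open>simp add: T_def\<close>)
    show "(\<lambda>k. 1 / (real k + 1)) \<longlonglongrightarrow> 0"
      by real_asymp
  qed
  \<comment> \<open>Both transforms are within 1 of \<open>exp (V / 2)\<close>.\<close>
  moreover have "(\<integral>x. exp x \<partial>\<mu> k) + (\<integral>x. exp (- x) \<partial>\<mu> k) \<le> 2 * exp (V / 2) + 2" for k
  proof -
    have "\<bar>(\<integral>x. exp x \<partial>\<mu> k) - exp (V / 2)\<bar> \<le> 1 / (real k + 1)"
      "\<bar>(\<integral>x. exp (- x) \<partial>\<mu> k) - exp (V / 2)\<bar> \<le> 1 / (real k + 1)"
      using lap(2)[of 1 k] lap(2)[of "-1" k] by (simp_all add: T_def)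
    moreover have "1 / (real k + 1) \<le> 1"
      by simp
    ultimately show ?thesis
      by linarith
  qed
  moreover have "integrable (\<mu> k) exp" "integrable (\<mu> k) (\<lambda>x. exp (- x))" for k
    using lap(1)[of 1 k] lap(1)[of "-1" k] by (simp_all add: T_def)
  ultimately obtain \<rho> where "weak_conv_m (\<lambda>k. \<mu> (\<rho> k)) (gaussian 0 V)"
    using weak_conv_gaussian_subseq[of \<mu> "2 * exp (V / 2) + 2" V] dist V by metis
  then have "\<forall>\<^sub>F k in sequentially.
      \<forall>h\<in>BL_functions. \<bar>(\<integral>x. h x \<partial>\<mu> (\<rho> k)) - (\<integral>x. h x \<partial>gaussian 0 V)\<bar> \<le> e"
    by (intro weak_conv_uniform_BL dist real_distribution_gaussian V e)
  then show False
    using far by (auto simp: eventually_sequentially not_le[symmetric])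
qed

section \<open>Second-order expansion of the mass of a tilted density\<close>

lemma space_lebesgue01 [simp]: "space lebesgue01 = {0..1}"
  by (simp add: lebesgue01_def)

lemma prob_density01_integrable: "prob_density01 f \<Longrightarrow> integrable lebesgue01 f"
  unfolding prob_density01_def by (metis not_integrable_integral_eq zero_neq_one)

lemma integrable_bounded_mult:
  fixes f g :: "real \<Rightarrow> real"
  assumes f: "integrable lebesgue01 f" and g: "g \<in> borel_measurable lebesgue01"
    and le: "\<And>x. x \<in> {0..1} \<Longrightarrow> \<bar>g x\<bar> \<le> K"
  shows "integrable lebesgue01 (\<lambda>x. g x * f x)"
proof (rule Bochner_Integration.integrable_bound)
  show "integrable lebesgue01 (\<lambda>x. K * f x)"
    using f by simp
  show "AE x in lebesgue01. norm (g x * f x) \<le> norm (K * f x)"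
    using le by (intro AE_I2) (simp add: abs_mult mult_right_mono order_trans[OF _ abs_ge_self])
qed (use f g in measurable)

lemma integral_bounded_mult_le:
  fixes f g :: "real \<Rightarrow> real"
  assumes f: "integrable lebesgue01 f" and g: "g \<in> borel_measurable lebesgue01"
    and le: "\<And>x. x \<in> {0..1} \<Longrightarrow> \<bar>g x\<bar> \<le> K"
  shows "\<bar>\<integral>x. g x * f x \<partial>lebesgue01\<bar> \<le> K * (\<integral>x. \<bar>f x\<bar> \<partial>lebesgue01)"
proof -
  have "\<bar>\<integral>x. g x * f x \<partial>lebesgue01\<bar> \<le> (\<integral>x. K * \<bar>f x\<bar> \<partial>lebesgue01)"
    using f le
    by (intro integral_abs_bound_integral integrable_bounded_mult[OF f g, of K])
      (auto simp: abs_mult intro!: mult_right_mono)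
  then show ?thesis
    by simp
qed

text \<open>The Lagrange remainder has the constant \<open>exp t / 6\<close>, at most 1 since
  \<open>exp 1\<close> is at most 3.\<close>

lemma exp_minus_quadratic_bound:
  fixes x :: real
  assumes "\<bar>x\<bar> \<le> 1"
  shows "\<bar>exp x - 1 - x - x\<^sup>2 / 2\<bar> \<le> \<bar>x\<bar> ^ 3"
proof -
  obtain t where t: "\<bar>t\<bar> \<le> \<bar>x\<bar>" and eq: "exp x = (\<Sum>m<3. x ^ m / fact m) + exp t / fact 3 * x ^ 3"
    using Maclaurin_exp_le by blast
  have "exp t \<le> exp 1"
    using t assms by simp
  then have "exp t \<le> 6"
    using exp_le by linarith
  moreover have "exp x - 1 - x - x\<^sup>2 / 2 = exp t / 6 * x ^ 3"
    unfolding eq by (simp add: eval_nat_numeral)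
  ultimately show ?thesis
    using mult_right_mono[of "exp t / 6" 1 "\<bar>x\<bar> ^ 3"] by (simp only: abs_mult power_abs) simp
qed

text \<open>The constraints on \<open>c\<close> keep the exponents in \<open>[-1, 1]\<close> and the mass within \<open>1/2\<close> of \<open>1\<close>, where
  quadratic Taylor bounds for \<open>exp\<close> and \<open>ln\<close> apply.\<close>

lemma ln_tilted_mass:
  fixes f f0 h :: "real \<Rightarrow> real" and c M \<epsilon> :: real
  defines "I \<equiv> \<integral>x. f x * exp (- c * h x) \<partial>lebesgue01"
  assumes f: "prob_density01 f" and f0: "prob_density01 f0"
    and h: "h \<in> borel_measurable lebesgue01" and M: "\<And>x. x \<in> {0..1} \<Longrightarrow> \<bar>h x\<bar> \<le> M"
    and centered: "(\<integral>x. h x * f0 x \<partial>lebesgue01) = 0"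
    and L1: "L1_dist f f0 \<le> \<epsilon>"
    and c: "\<bar>c\<bar> * M \<le> 1" and small: "\<bar>c\<bar> * (M * \<epsilon> + 2 * \<bar>c\<bar> * M\<^sup>2) \<le> 1 / 2"
  shows "0 < I"
    and "\<bar>ln I + c * (\<integral>x. h x * f x \<partial>lebesgue01) - c\<^sup>2 / 2 * (\<integral>x. (h x)\<^sup>2 * f0 x \<partial>lebesgue01)\<bar>
      \<le> c\<^sup>2 * M\<^sup>2 * \<epsilon> / 2 + \<bar>c\<bar> ^ 3 * M ^ 3 + 2 * c\<^sup>2 * (M * \<epsilon> + 2 * \<bar>c\<bar> * M\<^sup>2)\<^sup>2"
proof -
  note [measurable] = h
  define R where "R = (\<lambda>x. exp (- c * h x) - 1 + c * h x - c\<^sup>2 / 2 * (h x)\<^sup>2)"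
  define m1 where "m1 = (\<integral>x. h x * f x \<partial>lebesgue01)"
  define m2 where "m2 = (\<integral>x. (h x)\<^sup>2 * f x \<partial>lebesgue01)"
  define V where "V = (\<integral>x. (h x)\<^sup>2 * f0 x \<partial>lebesgue01)"
  define S where "S = (\<integral>x. R x * f x \<partial>lebesgue01)"
  note fi = prob_density01_integrable[OF f] and f0i = prob_density01_integrable[OF f0]
  have M0: "0 \<le> M"
    using M[of 0] by simp
  have eps0: "0 \<le> \<epsilon>"
    using L1 by (rule order_trans[rotated]) (simp add: L1_dist_def)
  have abs_f: "(\<integral>x. \<bar>f x\<bar> \<partial>lebesgue01) = 1"
  proof -
    have "(\<integral>x. \<bar>f x\<bar> \<partial>lebesgue01) = (\<integral>x. f x \<partial>lebesgue01)"
      using f by (intro Bochner_Integration.integral_cong) (auto simp: prob_density01_def)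
    then show ?thesis
      using f by (simp add: prob_density01_def)
  qed
  have R_meas [measurable]: "R \<in> borel_measurable lebesgue01"
    unfolding R_def by measurable
  have h2: "\<bar>(h x)\<^sup>2\<bar> \<le> M\<^sup>2" if "x \<in> {0..1}" for x
    using M[OF that] by (metis abs_ge_zero power2_abs power_mono abs_power2)
  have R_le: "\<bar>R x\<bar> \<le> \<bar>c\<bar> ^ 3 * M ^ 3" if "x \<in> {0..1}" for x
  proof -
    have ch: "\<bar>- c * h x\<bar> \<le> \<bar>c\<bar> * M"
      using M[OF that] by (simp add: abs_mult mult_left_mono)
    then have "\<bar>exp (- c * h x) - 1 - (- c * h x) - (- c * h x)\<^sup>2 / 2\<bar> \<le> \<bar>- c * h x\<bar> ^ 3"
      using c by (intro exp_minus_quadratic_bound) simp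
    also have "\<dots> \<le> (\<bar>c\<bar> * M) ^ 3"
      using ch by (intro power_mono) auto
    finally show ?thesis
      by (simp add: R_def power_mult_distrib)
  qed
  have int: "integrable lebesgue01 (\<lambda>x. h x * f x)" "integrable lebesgue01 (\<lambda>x. (h x)\<^sup>2 * f x)"
    "integrable lebesgue01 (\<lambda>x. R x * f x)"
    "integrable lebesgue01 (\<lambda>x. h x * f0 x)" "integrable lebesgue01 (\<lambda>x. (h x)\<^sup>2 * f0 x)"
    by (rule integrable_bounded_mult[OF _ _ M] integrable_bounded_mult[OF _ _ h2]
        integrable_bounded_mult[OF _ _ R_le], (simp_all add: fi f0i)[3])+
  have I_eq: "I = 1 - c * m1 + c\<^sup>2 / 2 * m2 + S"
  proof -
    have "I = (\<integral>x. f x - c * (h x * f x) + c\<^sup>2 / 2 * ((h x)\<^sup>2 * f x) + R x * f x \<partial>lebesgue01)"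
      unfolding I_def by (intro Bochner_Integration.integral_cong) (auto simp: R_def algebra_simps)
    also have "\<dots> = (\<integral>x. f x \<partial>lebesgue01) - c * m1 + c\<^sup>2 / 2 * m2 + S"
      using int fi by (simp add: m1_def m2_def S_def)
    finally show ?thesis
      using f by (simp add: prob_density01_def)
  qed
  have diff_le: "\<bar>(\<integral>x. g x * f x \<partial>lebesgue01) - (\<integral>x. g x * f0 x \<partial>lebesgue01)\<bar> \<le> K * \<epsilon>"
    if [measurable]: "g \<in> borel_measurable lebesgue01" and K: "\<And>x. x \<in> {0..1} \<Longrightarrow> \<bar>g x\<bar> \<le> K" for g K
  proof -
    have "0 \<le> K"
      using K[of 0] by simp
    have "(\<integral>x. g x * f x \<partial>lebesgue01) - (\<integral>x. g x * f0 x \<partial>lebesgue01)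
        = (\<integral>x. g x * (f x - f0 x) \<partial>lebesgue01)"
      using integrable_bounded_mult[OF fi that] integrable_bounded_mult[OF f0i that]
      by (simp add: right_diff_distrib)
    also have "\<bar>\<dots>\<bar> \<le> K * L1_dist f f0"
      unfolding L1_dist_def using fi f0i K by (intro integral_bounded_mult_le) auto
    also have "\<dots> \<le> K * \<epsilon>"
      using L1 \<open>0 \<le> K\<close> by (rule mult_left_mono)
    finally show ?thesis .
  qed
  \<comment> \<open>Centring turns the mean of \<open>h\<close> under \<open>f\<close> into a
    difference of means under \<open>f\<close> and \<open>f0\<close>, which L1 closeness
    controls.\<close>
  have m1_le: "\<bar>m1\<bar> \<le> M * \<epsilon>"
    using diff_le[OF h M] centered by (simp add: m1_def)
  have m2_V: "\<bar>m2 - V\<bar> \<le> M\<^sup>2 * \<epsilon>"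
    unfolding m2_def V_def by (rule diff_le) (use h2 in auto)
  have m2_le: "\<bar>m2\<bar> \<le> M\<^sup>2"
    using integral_bounded_mult_le[OF fi _ h2] by (simp add: abs_f m2_def)
  have S_le: "\<bar>S\<bar> \<le> \<bar>c\<bar> ^ 3 * M ^ 3"
    using integral_bounded_mult_le[OF fi R_meas R_le] by (simp add: abs_f S_def)
  define u where "u = - c * m1 + c\<^sup>2 / 2 * m2 + S"
  \<comment> \<open>The factor 2 absorbs 1/2 from the quadratic term and 1 from the cubic remainder,
    which \<open>\<bar>c\<bar> * M \<le> 1\<close> reduces to second order.\<close>
  have u_le: "\<bar>u\<bar> \<le> \<bar>c\<bar> * (M * \<epsilon> + 2 * \<bar>c\<bar> * M\<^sup>2)"
  proof -
    have "\<bar>c * m1\<bar> \<le> \<bar>c\<bar> * (M * \<epsilon>)"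
      using m1_le by (simp add: abs_mult mult_left_mono)
    moreover have "\<bar>c\<^sup>2 / 2 * m2\<bar> \<le> c\<^sup>2 * M\<^sup>2 / 2"
      using mult_left_mono[OF m2_le, of "c\<^sup>2 / 2"] by (simp add: abs_mult)
    moreover have "\<bar>c\<bar> ^ 3 * M ^ 3 \<le> c\<^sup>2 * M\<^sup>2"
    proof -
      have "\<bar>c\<bar> ^ 3 * M ^ 3 = (c\<^sup>2 * M\<^sup>2) * (\<bar>c\<bar> * M)"
        by (simp add: power3_eq_cube power2_eq_square)
      also have "\<dots> \<le> (c\<^sup>2 * M\<^sup>2) * 1"
        by (rule mult_left_mono[OF c]) simp
      finally show ?thesis by simp
    qed
    moreover have "\<bar>c\<bar> * (M * \<epsilon> + 2 * \<bar>c\<bar> * M\<^sup>2) = \<bar>c\<bar> * (M * \<epsilon>) + 2 * (c\<^sup>2 * M\<^sup>2)"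
      by (simp add: algebra_simps power2_eq_square)
    moreover have "0 \<le> c\<^sup>2 * M\<^sup>2"
      by simp
    ultimately show ?thesis
      using S_le unfolding u_def by linarith
  qed
  then have u_half: "\<bar>u\<bar> \<le> 1 / 2"
    using small by linarith
  have I_u: "I = 1 + u"
    by (simp add: I_eq u_def)
  show "0 < I"
    using u_half by (simp add: I_u abs_le_iff)
  have "\<bar>ln (1 + u) - u\<bar> \<le> 2 * u\<^sup>2"
    by (rule abs_ln_one_plus_x_minus_x_bound[OF u_half])
  also have "u\<^sup>2 \<le> (\<bar>c\<bar> * (M * \<epsilon> + 2 * \<bar>c\<bar> * M\<^sup>2))\<^sup>2"
    using u_le by (metis abs_ge_zero power2_abs power_mono)
  finally have "\<bar>ln I - u\<bar> \<le> 2 * c\<^sup>2 * (M * \<epsilon> + 2 * \<bar>c\<bar> * M\<^sup>2)\<^sup>2"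
    by (simp add: I_u power_mult_distrib)
  moreover have "\<bar>c\<^sup>2 / 2 * m2 - c\<^sup>2 / 2 * V\<bar> \<le> c\<^sup>2 * M\<^sup>2 * \<epsilon> / 2"
  proof -
    have "\<bar>c\<^sup>2 / 2 * (m2 - V)\<bar> \<le> c\<^sup>2 / 2 * (M\<^sup>2 * \<epsilon>)"
      using mult_left_mono[OF m2_V, of "c\<^sup>2 / 2"] by (simp add: abs_mult)
    then show ?thesis
      unfolding right_diff_distrib by simp
  qed
  ultimately show "\<bar>ln I + c * (\<integral>x. h x * f x \<partial>lebesgue01) - c\<^sup>2 / 2 * (\<integral>x. (h x)\<^sup>2 * f0 x \<partial>lebesgue01)\<bar>
      \<le> c\<^sup>2 * M\<^sup>2 * \<epsilon> / 2 + \<bar>c\<bar> ^ 3 * M ^ 3 + 2 * c\<^sup>2 * (M * \<epsilon> + 2 * \<bar>c\<bar> * M\<^sup>2)\<^sup>2"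
    using S_le unfolding u_def m1_def[symmetric] V_def[symmetric] by linarith
qed

section \<open>Tilted likelihoods and Laplace transforms of the posterior\<close>

lemma frac_lik_nonneg: "0 \<le> frac_lik \<alpha> n y f"
  by (simp add: frac_lik_def eexp_def)

text \<open>The product form of the likelihood keeps the identity valid when \<open>f\<close>
  vanishes at an observation: both sides are then 0, and no infinite logarithm has to be
  subtracted.\<close>

lemma frac_lik_exp_tilt:
  fixes f h :: "real \<Rightarrow> real" and c :: real
  defines "I \<equiv> \<integral>x. f x * exp (- c * h x) \<partial>lebesgue01"
  assumes \<alpha>: "0 < \<alpha>" and f: "\<And>i. i < n \<Longrightarrow> 0 \<le> f (y i)" and I: "0 < I"
  shows "frac_lik \<alpha> n y (exp_tilt h c f)
    = frac_lik \<alpha> n y f * exp (- (\<alpha> * (c * (\<Sum>i<n. h (y i)) + real n * ln I)))"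
proof -
  have tilt: "exp_tilt h c f x = f x * exp (- c * h x - ln I)" for x
    using I unfolding exp_tilt_def I_def[symmetric] by (simp add: exp_diff)
  have "frac_lik \<alpha> n y (exp_tilt h c f) = (\<Prod>i<n. (f (y i) * exp (- c * h (y i) - ln I)) powr \<alpha>)"
    using \<alpha> f by (simp add: frac_lik_eq_prod tilt)
  also have "\<dots> = (\<Prod>i<n. f (y i) powr \<alpha> * exp (\<alpha> * (- c * h (y i) - ln I)))"
    using f by (intro prod.cong) (auto simp: powr_mult exp_powr_real mult.commute)
  also have "\<dots> = frac_lik \<alpha> n y f * exp (\<Sum>i<n. \<alpha> * (- c * h (y i) - ln I))"
    using \<alpha> f by (simp add: prod.distrib frac_lik_eq_prod exp_sum)
  also have "(\<Sum>i<n. \<alpha> * (- c * h (y i) - ln I)) = - (\<alpha> * (c * (\<Sum>i<n. h (y i)) + real n * ln I))"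
    by (simp add: sum_subtractf sum_negf sum_distrib_left right_diff_distrib algebra_simps)
  finally show ?thesis .
qed

text \<open>The hypothesis \<open>X \<noteq> 0\<close> carries the integrability of \<open>w'\<close> over \<open>A\<close>: the Bochner integral of a
  non-integrable function is \<open>0\<close>.\<close>

lemma density_laplace_bounds:
  fixes P :: "'a measure" and w w' \<tau> :: "'a \<Rightarrow> real" and t \<beta> G :: real and A :: "'a set"
  defines "D \<equiv> \<integral>x. w x \<partial>P"
  defines "X \<equiv> (LINT x:A|P. w' x) / D" and "p \<equiv> (LINT x:A|P. w x) / D"
  defines "L \<equiv> \<integral>x. exp (t * (indicator A x * \<tau> x)) \<partial>density P (\<lambda>x. ennreal (w x / D))"
  assumes w [measurable]: "w \<in> borel_measurable P" and w0: "\<And>x. 0 \<le> w x" and D: "D \<noteq> 0"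
    and A [measurable]: "A \<in> sets P" and \<tau> [measurable]: "\<tau> \<in> borel_measurable P"
    and upper: "\<And>x. x \<in> A \<Longrightarrow> w x * exp (t * \<tau> x) \<le> exp \<beta> * G * w' x"
    and lower: "\<And>x. x \<in> A \<Longrightarrow> exp (- \<beta>) * G * w' x \<le> w x * exp (t * \<tau> x)"
    and X: "X \<noteq> 0"
  shows "integrable (density P (\<lambda>x. ennreal (w x / D))) (\<lambda>x. exp (t * (indicator A x * \<tau> x)))"
    and "L \<le> exp \<beta> * G * X + (1 - p)" and "exp (- \<beta>) * G * X + (1 - p) \<le> L"
proof -
  have w_int: "integrable P w"
    using D unfolding D_def by (metis not_integrable_integral_eq)
  have D_pos: "0 < D"
    using D w0 unfolding D_def by (metis integral_nonneg_AE AE_I2 less_eq_real_def)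
  define j where "j = (\<lambda>x. indicator A x * (w x * exp (t * \<tau> x)))"
  define k where "k = (\<lambda>x. indicator A x * w' x)"
  define l where "l = (\<lambda>x. indicator A x * w x)"
  have set_k: "(LINT x:A|P. w' x) = (\<integral>x. k x \<partial>P)" and set_l: "(LINT x:A|P. w x) = (\<integral>x. l x \<partial>P)"
    by (simp_all add: set_lebesgue_integral_def k_def l_def)
  have k_int: "integrable P k"
    using X unfolding X_def set_k by (metis not_integrable_integral_eq div_0)
  have l_int: "integrable P l"
    unfolding l_def using w_int integrable_real_mult_indicator[OF A w_int] by (simp add: mult.commute)
  have j_le: "j x \<le> exp \<beta> * G * k x" and j_ge: "exp (- \<beta>) * G * k x \<le> j x" for x
    using upper lower by (auto simp: j_def k_def split: split_indicator)
  have j0: "0 \<le> j x" for x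
    using w0 by (simp add: j_def)
  \<comment> \<open>Integrability of the exponential moment on \<open>A\<close> comes from the
    tilted likelihood, since \<open>0 \<le> j\<close> and \<open>j\<close> lies below a multiple of
    the integrable \<open>k\<close>.\<close>
  have j_int: "integrable P j"
  proof (rule Bochner_Integration.integrable_bound)
    show "integrable P (\<lambda>x. exp \<beta> * G * k x)"
      using k_int by simp
    show "AE x in P. norm (j x) \<le> norm (exp \<beta> * G * k x)"
      using j_le j0 by (intro AE_I2) (smt (verit) real_norm_def)
  qed (simp add: j_def)
  \<comment> \<open>Outside \<open>A\<close> the exponent is 0 and the bare posterior density
    remains; this is the origin of the term \<open>1 - p\<close>.\<close>
  have eq: "w x / D * exp (t * (indicator A x * \<tau> x)) = j x / D + (w x / D - l x / D)" for x
    by (simp add: j_def l_def split: split_indicator)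
  show "integrable (density P (\<lambda>x. ennreal (w x / D))) (\<lambda>x. exp (t * (indicator A x * \<tau> x)))"
    using D_pos w0 j_int w_int l_int by (subst integrable_density) (auto simp: eq simp del: times_divide_eq_left)
  have L_eq: "L = (\<integral>x. j x \<partial>P) / D + (1 - p)"
    unfolding L_def p_def set_l using D_pos w0 j_int w_int l_int
    by (subst integral_density) (auto simp: eq D_def[symmetric] simp del: times_divide_eq_left)
  have "(\<integral>x. j x \<partial>P) \<le> (\<integral>x. exp \<beta> * G * k x \<partial>P)" "(\<integral>x. exp (- \<beta>) * G * k x \<partial>P) \<le> (\<integral>x. j x \<partial>P)"
    by (intro integral_mono integrable_mult_right j_int k_int j_le j_ge)+
  then show "L \<le> exp \<beta> * G * X + (1 - p)" "exp (- \<beta>) * G * X + (1 - p) \<le> L"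
    unfolding L_eq X_def set_k using D_pos by (simp_all add: field_simps)
qed

text \<open>A nonzero Bochner integral of a nonnegative function carries both integrability and
  strict positivity, which is what normalising requires.\<close>

lemma prob_space_density_normalized:
  fixes P :: "'a measure" and w :: "'a \<Rightarrow> real"
  assumes w [measurable]: "w \<in> borel_measurable P" "\<And>x. 0 \<le> w x" and D: "(\<integral>x. w x \<partial>P) \<noteq> 0"
  shows "prob_space (density P (\<lambda>x. ennreal (w x / (\<integral>x. w x \<partial>P))))"
proof (rule prob_spaceI)
  let ?D = "\<integral>x. w x \<partial>P"
  have int: "integrable P w"
    using D by (metis not_integrable_integral_eq)
  have "0 \<le> ?D"
    using w by simp
  then have "(\<integral>\<^sup>+ x. ennreal (w x / ?D) \<partial>P) = ennreal (\<integral>x. w x / ?D \<partial>P)"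
    using w int by (intro nn_integral_eq_integral) auto
  then show "emeasure (density P (\<lambda>x. ennreal (w x / ?D))) (space (density P (\<lambda>x. ennreal (w x / ?D)))) = 1"
    using D by (simp add: emeasure_density cong: nn_integral_cong)
qed

lemma prob_space_sample_law:
  assumes "prob_density01 f"
  shows "prob_space (sample_law f n)"
proof -
  have "(\<integral>\<^sup>+ x. ennreal (f x) \<partial>lebesgue01) = ennreal (\<integral>x. f x \<partial>lebesgue01)"
    using assms prob_density01_integrable[OF assms]
    by (intro nn_integral_eq_integral) (auto simp: prob_density01_def)
  also have "\<dots> = 1"
    using assms by (simp add: prob_density01_def)
  finally have "emeasure (density lebesgue01 (\<lambda>x. ennreal (f x))) (space lebesgue01) = 1"
    using assms
    by (subst emeasure_density) (auto simp: prob_density01_def simp del: space_lebesgue01 cong: nn_integral_cong)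
  then have "prob_space (density lebesgue01 (\<lambda>x. ennreal (f x)))"
    by (intro prob_spaceI) simp
  then show ?thesis
    unfolding sample_law_def by (intro prob_space_PiM)
qed

lemma sample_law_in_unit_interval: "y \<in> space (sample_law f n) \<Longrightarrow> i < n \<Longrightarrow> y i \<in> {0..1}"
  by (auto simp: sample_law_def space_PiM PiE_iff)

text \<open>Sections of the jointly measurable evaluation map make \<open>f (y i)\<close> measurable
  in \<open>f\<close>, and the product formula transfers this to the likelihood.\<close>

lemma frac_lik_measurable:
  assumes P: "density_prior P" and \<alpha>: "0 < \<alpha>" and y: "\<And>i. i < n \<Longrightarrow> y i \<in> {0..1}"
  shows "frac_lik \<alpha> n y \<in> borel_measurable P"
proof -
  have [measurable]: "(\<lambda>f. f (y i)) \<in> borel_measurable P" if "i < n" for i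
    using P y[OF that] measurable_compose[OF measurable_Pair2', of "y i" lebesgue01 "\<lambda>(f, x). f x" P borel]
    by (simp add: density_prior_def)
  have "(\<lambda>f. \<Prod>i<n. f (y i) powr \<alpha>) \<in> borel_measurable P"
    by measurable
  moreover have "frac_lik \<alpha> n y f = (\<Prod>i<n. f (y i) powr \<alpha>)" if "f \<in> space P" for f
    using P \<alpha> y that by (intro frac_lik_eq_prod) (auto simp: density_prior_def prob_density01_def)
  ultimately show ?thesis
    by (subst measurable_cong) auto
qed

text \<open>Since \<open>s\<^sup>2 = n * \<alpha>\<close>, the factor \<open>\<alpha> * n\<close> in
  front of \<open>ln I\<close> turns its linear term into \<open>t * s\<close> times the mean of
  \<open>h\<close> under \<open>f\<close>, and its quadratic term into
  \<open>t\<^sup>2 * V / 2\<close>. Here \<open>d\<close> stands for the increment of the functional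
  and \<open>q\<close> for its remainder. The number \<open>b\<close> may vary with
  \<open>f\<close>, but its bound does not.\<close>

lemma frac_lik_tilt_expansion:
  fixes f f0 h :: "real \<Rightarrow> real" and t \<alpha> M \<epsilon> \<rho> d q :: real and n :: nat
  defines "s \<equiv> sqrt (real n * \<alpha>)"
  defines "V \<equiv> \<integral>x. (h x)\<^sup>2 * f0 x \<partial>lebesgue01"
  defines "\<kappa> \<equiv> M * \<epsilon> + 2 * (\<bar>t\<bar> / s) * M\<^sup>2"
  assumes n: "0 < n" and \<alpha>: "0 < \<alpha>"
    and f: "prob_density01 f" and f0: "prob_density01 f0"
    and h: "h \<in> borel_measurable lebesgue01" and M: "\<And>x. x \<in> {0..1} \<Longrightarrow> \<bar>h x\<bar> \<le> M"
    and centered: "(\<integral>x. h x * f0 x \<partial>lebesgue01) = 0"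
    and L1: "L1_dist f f0 \<le> \<epsilon>"
    and small: "\<bar>t\<bar> / s * M \<le> 1" "\<bar>t\<bar> / s * \<kappa> \<le> 1 / 2"
    and y: "\<And>i. i < n \<Longrightarrow> y i \<in> {0..1}"
    and d: "d = (\<integral>x. h x * f x \<partial>lebesgue01) + q" and q: "s * \<bar>q\<bar> \<le> \<rho>"
  obtains b where
    "\<bar>b\<bar> \<le> t\<^sup>2 * M\<^sup>2 * \<epsilon> / 2 + \<bar>t\<bar> ^ 3 * M ^ 3 / s + 2 * t\<^sup>2 * \<kappa>\<^sup>2 + \<bar>t\<bar> * \<rho>"
    "frac_lik \<alpha> n y (exp_tilt h (t / s) f)
      = frac_lik \<alpha> n y f * exp (t * (s * (d - 1 / real n * (\<Sum>i<n. h (y i)))) - t\<^sup>2 * V / 2 + b)"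
proof -
  define c where "c = t / s"
  define I where "I = (\<integral>x. f x * exp (- c * h x) \<partial>lebesgue01)"
  define m where "m = (\<integral>x. h x * f x \<partial>lebesgue01)"
  define S where "S = (\<Sum>i<n. h (y i))"
  define E where "E = ln I + c * m - c\<^sup>2 / 2 * V"
  have s: "0 < s" and s2: "s\<^sup>2 = real n * \<alpha>"
    using n \<alpha> by (simp_all add: s_def)
  have abs_c: "\<bar>c\<bar> = \<bar>t\<bar> / s"
    using s by (simp add: c_def)
  have I: "0 < I" and E: "\<bar>E\<bar> \<le> c\<^sup>2 * M\<^sup>2 * \<epsilon> / 2 + \<bar>c\<bar> ^ 3 * M ^ 3 + 2 * c\<^sup>2 * \<kappa>\<^sup>2"
    using ln_tilted_mass[OF f f0 h M centered L1, of c] small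
    unfolding E_def I_def m_def V_def \<kappa>_def abs_c by auto
  \<comment> \<open>Taking \<open>b\<close> as the total discrepancy makes the likelihood identity
    immediate; the work is to see that it collapses to
    \<open>- s\<^sup>2 * E - t * (s * q)\<close>.\<close>
  define b where "b = - (\<alpha> * (c * S + real n * ln I)) - t * (s * (d - 1 / real n * S)) + t\<^sup>2 * V / 2"
  have ts: "t = c * s"
    using s by (simp add: c_def)
  have "b = - s\<^sup>2 * E - t * (s * q)"
  proof -
    have eqs: "t * (s * (1 / real n * S)) = \<alpha> * (c * S)"
      "t * (s * d) = s\<^sup>2 * (c * m) + t * (s * q)"
      "\<alpha> * (real n * ln I) = s\<^sup>2 * ln I"
      "t\<^sup>2 * V / 2 = s\<^sup>2 * (c\<^sup>2 / 2 * V)"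
    proof -
      have "t * (s * (1 / real n * S)) = c * S * (s\<^sup>2 / real n)"
        by (simp add: ts power2_eq_square)
      then show "t * (s * (1 / real n * S)) = \<alpha> * (c * S)"
        using n by (simp add: s2)
      show "t * (s * d) = s\<^sup>2 * (c * m) + t * (s * q)"
        by (simp add: d m_def ts power2_eq_square algebra_simps)
      show "\<alpha> * (real n * ln I) = s\<^sup>2 * ln I"
        by (simp add: s2)
      show "t\<^sup>2 * V / 2 = s\<^sup>2 * (c\<^sup>2 / 2 * V)"
        by (simp add: ts power_mult_distrib)
    qed
    have "b = - (\<alpha> * (c * S) + s\<^sup>2 * ln I) - (s\<^sup>2 * (c * m) + t * (s * q) - \<alpha> * (c * S))
        + s\<^sup>2 * (c\<^sup>2 / 2 * V)"
      by (simp only: b_def distrib_left right_diff_distrib eqs)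
    also have "\<dots> = - s\<^sup>2 * E - t * (s * q)"
      unfolding E_def distrib_left right_diff_distrib by simp
    finally show ?thesis .
  qed
  then have "\<bar>b\<bar> \<le> s\<^sup>2 * \<bar>E\<bar> + \<bar>t\<bar> * (s * \<bar>q\<bar>)"
    using s abs_triangle_ineq4[of "- s\<^sup>2 * E" "t * (s * q)"] by (simp add: abs_mult)
  also have "\<dots> \<le> s\<^sup>2 * (c\<^sup>2 * M\<^sup>2 * \<epsilon> / 2 + \<bar>c\<bar> ^ 3 * M ^ 3 + 2 * c\<^sup>2 * \<kappa>\<^sup>2) + \<bar>t\<bar> * \<rho>"
    using E q by (intro add_mono mult_left_mono) auto
  also have "\<dots> = t\<^sup>2 * M\<^sup>2 * \<epsilon> / 2 + \<bar>t\<bar> ^ 3 * M ^ 3 / s + 2 * t\<^sup>2 * \<kappa>\<^sup>2 + \<bar>t\<bar> * \<rho>"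
    unfolding abs_c c_def using s by (simp add: field_simps power2_eq_square power3_eq_cube)
  finally have b: "\<bar>b\<bar> \<le> \<dots>" .
  have "frac_lik \<alpha> n y (exp_tilt h c f) = frac_lik \<alpha> n y f * exp (- (\<alpha> * (c * S + real n * ln I)))"
    unfolding I_def S_def using f y \<alpha> I
    by (intro frac_lik_exp_tilt) (auto simp: prob_density01_def I_def)
  also have "\<dots> = frac_lik \<alpha> n y f * exp (t * (s * (d - 1 / real n * S)) - t\<^sup>2 * V / 2 + b)"
    by (simp add: b_def)
  finally show thesis
    using that[OF b] by (simp add: c_def S_def)
qed

section \<open>From estimates on an event to convergence in outer probability\<close>

text \<open>A real supremum is meaningful only for a nonempty bounded family: the zero function
  provides a member and also nonnegativity, and \<open>e\<close> provides the bound.\<close>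

lemma BL_dist_le:
  assumes "\<And>h. h \<in> BL_functions \<Longrightarrow> \<bar>(\<integral>x. h x \<partial>Q) - (\<integral>x. h x \<partial>R)\<bar> \<le> e"
  shows "\<bar>BL_dist Q R\<bar> \<le> e"
proof -
  let ?F = "\<lambda>h. \<bar>(\<integral>x. h x \<partial>Q) - (\<integral>x. h x \<partial>R)\<bar>"
  have eq: "BL_dist Q R = (SUP h\<in>BL_functions. ?F h)"
    by (simp add: BL_dist_def BL_functions_def)
  have zero: "(\<lambda>_. 0) \<in> BL_functions"
    by (auto simp: BL_functions_def intro!: lipschitz_onI)
  have "BL_dist Q R \<le> e"
    unfolding eq using zero assms by (intro cSUP_least) auto
  moreover have "?F (\<lambda>_. 0) \<le> BL_dist Q R"
    unfolding eq using zero assms by (intro cSUP_upper bdd_aboveI2) auto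
  ultimately show ?thesis
    by simp
qed

text \<open>Truncating the functional rather than the measure keeps a probability measure, as needed for
  characteristic functions.\<close>

lemma BL_truncation:
  assumes Q: "prob_space Q" and A [measurable]: "A \<in> sets Q" and \<tau> [measurable]: "\<tau> \<in> borel_measurable Q"
    and h: "h \<in> BL_functions"
  shows "\<bar>(\<integral>x. h x \<partial>distr Q borel \<tau>) - (\<integral>x. h x \<partial>distr Q borel (\<lambda>x. indicator A x * \<tau> x))\<bar>
    \<le> 2 * (1 - measure Q A)"
proof -
  interpret prob_space Q by fact
  note [measurable] = BL_functions_measurable[OF h]
  let ?\<tau>' = "\<lambda>x. indicator A x * \<tau> x"
  have int: "integrable Q (\<lambda>x. h (X x))" if [measurable]: "X \<in> borel_measurable Q" for X
    by (rule integrable_const_bound[of _ 1]) (use BL_functions_bounded[OF h] in auto)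
  have "(\<integral>x. h x \<partial>distr Q borel \<tau>) - (\<integral>x. h x \<partial>distr Q borel ?\<tau>')
      = (\<integral>x. h (\<tau> x) - h (?\<tau>' x) \<partial>Q)"
    by (simp add: integral_distr int)
  also have "\<bar>\<dots>\<bar> \<le> (\<integral>x. \<bar>h (\<tau> x) - h (?\<tau>' x)\<bar> \<partial>Q)"
    by (rule integral_abs_bound)
  also have "\<dots> \<le> (\<integral>x. 2 * indicator (space Q - A) x \<partial>Q)"
  proof (rule integral_mono)
    show "\<bar>h (\<tau> x) - h (?\<tau>' x)\<bar> \<le> 2 * indicator (space Q - A) x" if "x \<in> space Q" for x
      using that BL_functions_diff_le[OF h, of "\<tau> x" "?\<tau>' x"] by (auto split: split_indicator)
  qed (auto simp: int less_top[symmetric] intro!: integrable_real_indicator)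
  also have "\<dots> = 2 * (1 - measure Q A)"
    by (simp add: prob_compl)
  finally show ?thesis .
qed

text \<open>As \<open>\<eta>\<close> tends to 0, the extreme values that the two bounds allow for
  \<open>L\<close> both tend to \<open>G\<close>. The eventual form lets finitely many such
  statements, one for each \<open>t\<close>, share a tolerance.\<close>

lemma laplace_tolerance:
  fixes G \<delta> :: real
  assumes "0 < \<delta>" "0 \<le> G"
  shows "\<forall>\<^sub>F \<eta> in at_right 0. \<forall>\<beta> X p L. \<beta> \<le> \<eta> \<longrightarrow> \<bar>X - 1\<bar> \<le> \<eta> \<longrightarrow> \<bar>p - 1\<bar> \<le> \<eta> \<longrightarrow>
    L \<le> exp \<beta> * G * X + (1 - p) \<longrightarrow> exp (- \<beta>) * G * X + (1 - p) \<le> L \<longrightarrow> \<bar>L - G\<bar> \<le> \<delta>"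
proof -
  have "((\<lambda>\<eta>. exp \<eta> * G * (1 + \<eta>) + \<eta>) \<longlongrightarrow> exp 0 * G * (1 + 0) + 0) (at_right 0)"
    by (intro tendsto_intros)
  then have 1: "\<forall>\<^sub>F \<eta> in at_right 0. exp \<eta> * G * (1 + \<eta>) + \<eta> < G + \<delta>"
    using assms by (intro order_tendstoD) auto
  have "((\<lambda>\<eta>. exp (- \<eta>) * G * (1 - \<eta>) - \<eta>) \<longlongrightarrow> exp (- 0) * G * (1 - 0) - 0) (at_right 0)"
    by (intro tendsto_intros)
  then have 2: "\<forall>\<^sub>F \<eta> in at_right 0. G - \<delta> < exp (- \<eta>) * G * (1 - \<eta>) - \<eta>"
    using assms by (intro order_tendstoD) auto
  \<comment> \<open>\<open>\<eta> < 1\<close> keeps \<open>1 - \<eta>\<close> positive, as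
    monotonicity of the lower product requires.\<close>
  have 3: "\<forall>\<^sub>F \<eta> :: real in at_right 0. 0 < \<eta> \<and> \<eta> < 1"
    by (auto simp: eventually_at_right_field intro!: exI[of _ 1])
  from 1 2 3 show ?thesis
  proof eventually_elim
    fix \<eta> :: real
    assume up: "exp \<eta> * G * (1 + \<eta>) + \<eta> < G + \<delta>" and low: "G - \<delta> < exp (- \<eta>) * G * (1 - \<eta>) - \<eta>"
      and \<eta>: "0 < \<eta> \<and> \<eta> < 1"
    show "\<forall>\<beta> X p L. \<beta> \<le> \<eta> \<longrightarrow> \<bar>X - 1\<bar> \<le> \<eta> \<longrightarrow> \<bar>p - 1\<bar> \<le> \<eta> \<longrightarrow>
      L \<le> exp \<beta> * G * X + (1 - p) \<longrightarrow> exp (- \<beta>) * G * X + (1 - p) \<le> L \<longrightarrow> \<bar>L - G\<bar> \<le> \<delta>"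
    proof (intro allI impI)
      fix \<beta> X p L :: real
      assume *: "\<beta> \<le> \<eta>" "\<bar>X - 1\<bar> \<le> \<eta>" "\<bar>p - 1\<bar> \<le> \<eta>"
        "L \<le> exp \<beta> * G * X + (1 - p)" "exp (- \<beta>) * G * X + (1 - p) \<le> L"
      have "exp \<beta> * G * X \<le> exp \<eta> * G * (1 + \<eta>)" "exp (- \<eta>) * G * (1 - \<eta>) \<le> exp (- \<beta>) * G * X"
        using * \<eta> \<open>0 \<le> G\<close> by (auto intro!: mult_mono)
      then show "\<bar>L - G\<bar> \<le> \<delta>"
        using * up low by linarith
    qed
  qed
qed

text \<open>A union bound over the exceptional events of \<open>Y\<close> and of finitely many
  \<open>Z t\<close>. The finite set depends on \<open>e\<close>, hence convergence is assumed for
  every \<open>t\<close>.\<close>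

lemma tendsto_in_probI_good_event:
  fixes X Y :: "nat \<Rightarrow> 'a \<Rightarrow> real" and Z :: "'b \<Rightarrow> nat \<Rightarrow> 'a \<Rightarrow> real"
  assumes P: "\<And>n. prob_space (P n)"
    and Y: "tendsto_in_prob P Y b" and Z: "\<And>t. tendsto_in_prob P (Z t) c"
    and good: "\<And>e. 0 < e \<Longrightarrow> \<exists>T \<eta>. finite T \<and> 0 < \<eta> \<and> (\<forall>\<^sub>F n in sequentially.
      \<forall>w\<in>space (P n). \<bar>Y n w - b\<bar> \<le> \<eta> \<longrightarrow> (\<forall>t\<in>T. \<bar>Z t n w - c\<bar> \<le> \<eta>) \<longrightarrow> \<bar>X n w - a\<bar> \<le> e)"
  shows "tendsto_in_prob P X a"
  unfolding tendsto_in_prob_def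
proof (intro allI impI)
  fix e :: real assume "0 < e"
  then obtain T \<eta> where T: "finite T" and \<eta>: "0 < \<eta>"
    and "\<forall>\<^sub>F n in sequentially. \<forall>w\<in>space (P n).
      \<bar>Y n w - b\<bar> \<le> \<eta> \<longrightarrow> (\<forall>t\<in>T. \<bar>Z t n w - c\<bar> \<le> \<eta>) \<longrightarrow> \<bar>X n w - a\<bar> \<le> e"
    using good by blast
  then obtain N where N: "\<And>n w. N \<le> n \<Longrightarrow> w \<in> space (P n) \<Longrightarrow> \<bar>Y n w - b\<bar> \<le> \<eta> \<Longrightarrow>
      (\<forall>t\<in>T. \<bar>Z t n w - c\<bar> \<le> \<eta>) \<Longrightarrow> \<bar>X n w - a\<bar> \<le> e"
    unfolding eventually_sequentially by blast
  obtain E where "\<forall>n. E n \<in> sets (P n) \<and> {w \<in> space (P n). \<eta> < \<bar>Y n w - b\<bar>} \<subseteq> E n"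
    and E_lim: "(\<lambda>n. measure (P n) (E n)) \<longlonglongrightarrow> 0"
    using Y \<eta> unfolding tendsto_in_prob_def by blast
  then have E: "E n \<in> sets (P n)" "{w \<in> space (P n). \<eta> < \<bar>Y n w - b\<bar>} \<subseteq> E n" for n
    by blast+
  have "\<forall>t. \<exists>F. (\<forall>n. F n \<in> sets (P n) \<and> {w \<in> space (P n). \<eta> < \<bar>Z t n w - c\<bar>} \<subseteq> F n) \<and>
      (\<lambda>n. measure (P n) (F n)) \<longlonglongrightarrow> 0"
    using Z \<eta> unfolding tendsto_in_prob_def by blast
  from choice[OF this] obtain F where F': "\<forall>t. (\<forall>n. F t n \<in> sets (P n) \<and>
      {w \<in> space (P n). \<eta> < \<bar>Z t n w - c\<bar>} \<subseteq> F t n) \<and> (\<lambda>n. measure (P n) (F t n)) \<longlonglongrightarrow> 0"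
    by blast
  then have F: "F t n \<in> sets (P n)" "{w \<in> space (P n). \<eta> < \<bar>Z t n w - c\<bar>} \<subseteq> F t n" for t n
    by blast+
  have F_lim: "(\<lambda>n. measure (P n) (F t n)) \<longlonglongrightarrow> 0" for t
    using F' by blast
  \<comment> \<open>The bad set must be covered for every index, so the whole space is taken before
    \<open>N\<close>; this does not affect the limit.\<close>
  define B where "B = (\<lambda>n. if N \<le> n then E n \<union> (\<Union>t\<in>T. F t n) else space (P n))"
  have B_sets: "B n \<in> sets (P n)" for n
    unfolding B_def using E F T by (auto intro!: sets.Un sets.finite_UN)
  have "{w \<in> space (P n). e < \<bar>X n w - a\<bar>} \<subseteq> B n" for n
  proof (cases "N \<le> n")
    case True
    show ?thesis
    proof (intro subsetI, rule ccontr)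
      fix w assume w: "w \<in> {w \<in> space (P n). e < \<bar>X n w - a\<bar>}" and "w \<notin> B n"
      then have "w \<notin> E n" "\<forall>t\<in>T. w \<notin> F t n"
        using True by (auto simp: B_def)
      then have "\<bar>Y n w - b\<bar> \<le> \<eta>" "\<forall>t\<in>T. \<bar>Z t n w - c\<bar> \<le> \<eta>"
        using w E(2)[of n] F(2)[where n = n] by (auto simp: not_less[symmetric])
      then show False
        using N[OF True, of w] w by simp
    qed
  qed (auto simp: B_def)
  moreover have "(\<lambda>n. measure (P n) (B n)) \<longlonglongrightarrow> 0"
  proof (rule tendsto_sandwich[where f = "\<lambda>_. 0"])
    show "\<forall>\<^sub>F n in sequentially. measure (P n) (B n) \<le> measure (P n) (E n) + (\<Sum>t\<in>T. measure (P n) (F t n))"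
      using eventually_ge_at_top[of N]
    proof eventually_elim
      fix n assume "N \<le> n"
      interpret prob_space "P n" by (rule P)
      have "measure (P n) (B n) \<le> measure (P n) (E n) + measure (P n) (\<Union>t\<in>T. F t n)"
        using \<open>N \<le> n\<close> E F T by (auto simp: B_def intro!: measure_Un_le)
      also have "measure (P n) (\<Union>t\<in>T. F t n) \<le> (\<Sum>t\<in>T. measure (P n) (F t n))"
        using F T by (intro finite_measure_subadditive_finite) auto
      finally show "measure (P n) (B n) \<le> measure (P n) (E n) + (\<Sum>t\<in>T. measure (P n) (F t n))"
        by simp
    qed
    have "(\<lambda>n. measure (P n) (E n) + (\<Sum>t\<in>T. measure (P n) (F t n))) \<longlonglongrightarrow> 0 + (\<Sum>t\<in>T. 0)"
      by (intro tendsto_add tendsto_sum E_lim F_lim)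
    then show "(\<lambda>n. measure (P n) (E n) + (\<Sum>t\<in>T. measure (P n) (F t n))) \<longlonglongrightarrow> 0"
      by simp
  qed auto
  ultimately show "\<exists>E. (\<forall>n. E n \<in> sets (P n) \<and> {w \<in> space (P n). e < \<bar>X n w - a\<bar>} \<subseteq> E n) \<and>
      (\<lambda>n. measure (P n) (E n)) \<longlonglongrightarrow> 0"
    using B_sets by blast
qed

section \<open>The posterior limit, on events where mass and tilted ratios are near 1\<close>

theorem theorem2p4:
  fixes f0 :: "real \<Rightarrow> real"
    and Pri :: "nat \<Rightarrow> (real \<Rightarrow> real) measure"
    and \<alpha> \<epsilon> :: "nat \<Rightarrow> real"
    and \<psi> :: "(real \<Rightarrow> real) \<Rightarrow> real"
    and \<psi>t :: "real \<Rightarrow> real"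
    and r :: "(real \<Rightarrow> real) \<Rightarrow> (real \<Rightarrow> real) \<Rightarrow> real"
    and A :: "nat \<Rightarrow> (real \<Rightarrow> real) set"
  assumes f0: "prob_density01 f0"
    and prior: "\<And>n. density_prior (Pri n)"
    and alpha: "\<And>n. 0 < \<alpha> n \<and> \<alpha> n \<le> 1"
    and n_alpha: "filterlim (\<lambda>n. real n * \<alpha> n) at_top sequentially"
    and psi_measurable: "\<And>n. \<psi> \<in> borel_measurable (Pri n)"
    and psit_measurable: "\<psi>t \<in> borel_measurable lebesgue01"
    and psit_bounded: "bounded (\<psi>t ` {0..1})"
    and expansion: "\<And>f. prob_density01 f \<Longrightarrow>
          \<psi> f - \<psi> f0 = (\<integral>x. \<psi>t x * f x \<partial>lebesgue01) + r f f0"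
    and centered: "(\<integral>x. \<psi>t x * f0 x \<partial>lebesgue01) = 0"
    and eps: "\<epsilon> \<longlonglongrightarrow> 0"
    and A_measurable: "\<And>n. A n \<in> sets (Pri n)"
    and A_L1: "\<And>n. A n \<subseteq> {f. L1_dist f f0 \<le> \<epsilon> n}"
    and A_posterior: "tendsto_in_prob (sample_law f0)
          (\<lambda>n y. measure (frac_posterior (Pri n) (\<alpha> n) n y) (A n)) 1"
    and remainder: "(\<lambda>n. ennreal (sqrt (real n * \<alpha> n)) * (SUP f\<in>A n. ennreal \<bar>r f f0\<bar>)) \<longlonglongrightarrow> 0"
    and change_of_measure: "\<And>t. tendsto_in_prob (sample_law f0)
          (\<lambda>n y. (LINT f:A n|Pri n.
                    frac_lik (\<alpha> n) n y (exp_tilt \<psi>t (t / sqrt (real n * \<alpha> n)) f))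
                 / (\<integral>f. frac_lik (\<alpha> n) n y f \<partial>Pri n)) 1"
  shows "weakly_in_prob (sample_law f0)
           (\<lambda>n y. distr (frac_posterior (Pri n) (\<alpha> n) n y) borel
              (\<lambda>f. sqrt (real n * \<alpha> n) *
                 (\<psi> f - (\<psi> f0 + (1 / real n) * (\<Sum>i<n. \<psi>t (y i))))))
           (gaussian 0 (\<integral>x. (\<psi>t x)\<^sup>2 * f0 x \<partial>lebesgue01))"
proof -
  define V where "V = (\<integral>x. (\<psi>t x)\<^sup>2 * f0 x \<partial>lebesgue01)"
  define s where "s = (\<lambda>n. sqrt (real n * \<alpha> n))"
  define \<tau> where "\<tau> = (\<lambda>n y f. s n * (\<psi> f - (\<psi> f0 + (1 / real n) * (\<Sum>i<n. \<psi>t (y i)))))"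
  define p where "p = (\<lambda>n y. measure (frac_posterior (Pri n) (\<alpha> n) n y) (A n))"
  define X where "X = (\<lambda>t n y. (LINT f:A n|Pri n. frac_lik (\<alpha> n) n y (exp_tilt \<psi>t (t / s n) f))
    / (\<integral>f. frac_lik (\<alpha> n) n y f \<partial>Pri n))"
  obtain M where "\<forall>x\<in>{0..1}. \<bar>\<psi>t x\<bar> \<le> M"
    using psit_bounded unfolding bounded_real by blast
  then have M: "\<bar>\<psi>t x\<bar> \<le> M" if "x \<in> {0..1}" for x
    using that by blast
  have V: "0 \<le> V"
    unfolding V_def using f0 by (intro integral_nonneg_AE AE_I2) (simp add: prob_density01_def)
  \<comment> \<open>\<open>enn2real\<close> sends an infinite value to 0, so \<open>\<rho> n\<close>
    bounds the scaled remainder only where the product with the supremum is finite. The bound that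
    follows is therefore an eventual one.\<close>
  define \<rho> where "\<rho> = (\<lambda>n. enn2real (ennreal (s n) * (SUP f\<in>A n. ennreal \<bar>r f f0\<bar>)))"
  have \<rho>_lim: "\<rho> \<longlonglongrightarrow> 0"
    using tendsto_enn2real[of _ 0, unfolded ennreal_0, OF remainder] by (simp add: \<rho>_def s_def)
  have \<rho>_bound: "\<forall>\<^sub>F n in sequentially. \<forall>f\<in>A n. s n * \<bar>r f f0\<bar> \<le> \<rho> n"
  proof -
    have "\<forall>\<^sub>F n in sequentially. ennreal (s n) * (SUP f\<in>A n. ennreal \<bar>r f f0\<bar>) < 1"
      using order_tendstoD(2)[OF remainder, of 1] by (simp add: s_def)
    then show ?thesis
    proof eventually_elim
      fix n assume fin: "ennreal (s n) * (SUP f\<in>A n. ennreal \<bar>r f f0\<bar>) < 1"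
      have s0: "0 \<le> s n"
        using alpha[of n] by (simp add: s_def)
      show "\<forall>f\<in>A n. s n * \<bar>r f f0\<bar> \<le> \<rho> n"
      proof
        fix f assume "f \<in> A n"
        then have "ennreal (s n * \<bar>r f f0\<bar>) \<le> ennreal (s n) * (SUP f\<in>A n. ennreal \<bar>r f f0\<bar>)"
          using s0 by (simp add: ennreal_mult) (intro mult_left_mono SUP_upper, auto)
        moreover have "\<dots> < top"
          using fin by (rule less_trans) simp
        ultimately show "s n * \<bar>r f f0\<bar> \<le> \<rho> n"
          using s0 enn2real_mono[of "ennreal (s n * \<bar>r f f0\<bar>)"] by (simp add: \<rho>_def)
      qed
    qed
  qed
  have s_lim: "filterlim s at_top sequentially"
    unfolding s_def using n_alpha by (rule filterlim_compose[OF sqrt_at_top])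
  define \<kappa> where "\<kappa> = (\<lambda>t n. M * \<epsilon> n + 2 * (\<bar>t\<bar> / s n) * M\<^sup>2)"
  \<comment> \<open>The error bound of \<open>frac_lik_tilt_expansion\<close>, free of
    \<open>f\<close> and of the data.\<close>
  define \<beta> where "\<beta> = (\<lambda>t n. t\<^sup>2 * M\<^sup>2 * \<epsilon> n / 2 + \<bar>t\<bar> ^ 3 * M ^ 3 / s n + 2 * t\<^sup>2 * (\<kappa> t n)\<^sup>2 + \<bar>t\<bar> * \<rho> n)"
  have over_s: "(\<lambda>n. a / s n) \<longlonglongrightarrow> 0" for a
    by (rule tendsto_divide_0[OF tendsto_const filterlim_at_top_imp_at_infinity[OF s_lim]])
  have \<kappa>_lim: "\<kappa> t \<longlonglongrightarrow> 0" for t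
  proof -
    have "\<kappa> t \<longlonglongrightarrow> M * 0 + 2 * 0 * M\<^sup>2"
      unfolding \<kappa>_def by (intro tendsto_add tendsto_mult tendsto_const eps over_s)
    then show ?thesis
      by simp
  qed
  have \<beta>_lim: "\<beta> t \<longlonglongrightarrow> 0" for t
  proof -
    have "\<beta> t \<longlonglongrightarrow> t\<^sup>2 * M\<^sup>2 * 0 / 2 + 0 + 2 * t\<^sup>2 * 0\<^sup>2 + \<bar>t\<bar> * 0"
      unfolding \<beta>_def
      by (intro tendsto_add tendsto_mult tendsto_divide[OF _ tendsto_const] tendsto_power tendsto_const
          eps over_s \<kappa>_lim \<rho>_lim) simp
    then show ?thesis
      by simp
  qed
  have small: "\<forall>\<^sub>F n in sequentially. \<bar>t\<bar> / s n * M \<le> 1 \<and> \<bar>t\<bar> / s n * \<kappa> t n \<le> 1 / 2" for t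
  proof -
    have lim: "(\<lambda>n. \<bar>t\<bar> / s n * M) \<longlonglongrightarrow> 0" "(\<lambda>n. \<bar>t\<bar> / s n * \<kappa> t n) \<longlonglongrightarrow> 0"
      using tendsto_mult[OF over_s tendsto_const, of "\<bar>t\<bar>" M] tendsto_mult[OF over_s \<kappa>_lim, of "\<bar>t\<bar>" t]
      by simp_all
    have "\<forall>\<^sub>F n in sequentially. \<bar>t\<bar> / s n * M < 1" "\<forall>\<^sub>F n in sequentially. \<bar>t\<bar> / s n * \<kappa> t n < 1 / 2"
      by (rule order_tendstoD(2)[OF lim(1)] order_tendstoD(2)[OF lim(2)], simp)+
    then show ?thesis
      by eventually_elim simp
  qed
  have "tendsto_in_prob (sample_law f0)
      (\<lambda>n y. BL_dist (distr (frac_posterior (Pri n) (\<alpha> n) n y) borel (\<tau> n y)) (gaussian 0 V)) 0"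
  proof (rule tendsto_in_probI_good_event[OF prob_space_sample_law[OF f0]])
    show "tendsto_in_prob (sample_law f0) p 1"
      unfolding p_def by (rule A_posterior)
    show "tendsto_in_prob (sample_law f0) (X t) 1" for t
      unfolding X_def s_def by (rule change_of_measure)
    fix e :: real assume e: "0 < e"
    obtain T \<delta> where T: "finite T" and \<delta>: "0 < \<delta>" and close:
      "\<And>\<mu> h. real_distribution \<mu> \<Longrightarrow>
        (\<forall>t\<in>T. integrable \<mu> (\<lambda>x. exp (t * x)) \<and> \<bar>(\<integral>x. exp (t * x) \<partial>\<mu>) - exp (t\<^sup>2 * V / 2)\<bar> \<le> \<delta>) \<Longrightarrow>
        h \<in> BL_functions \<Longrightarrow> \<bar>(\<integral>x. h x \<partial>\<mu>) - (\<integral>x. h x \<partial>gaussian 0 V)\<bar> \<le> e / 2"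
      using laplace_close_imp_BL_close[OF V, of "e / 2"] e by (metis half_gt_zero)
    \<comment> \<open>Below 1/2, \<open>\<eta>\<close> keeps the posterior mass and the tilted
      ratios away from 0; below \<open>e / 4\<close>, it makes the truncation error
      \<open>2 * \<eta>\<close> at most \<open>e / 2\<close>.\<close>
    have ev1: "\<forall>\<^sub>F \<eta> in at_right 0. 0 < \<eta> \<and> \<eta> < min (1 / 2) (e / 4)"
      using e by (auto simp: eventually_at_right_field intro!: exI[of _ "min (1 / 2) (e / 4)"])
    have ev2: "\<forall>\<^sub>F \<eta> in at_right 0. \<forall>t\<in>T. \<forall>\<beta> X p L. \<beta> \<le> \<eta> \<longrightarrow> \<bar>X - 1\<bar> \<le> \<eta> \<longrightarrow> \<bar>p - 1\<bar> \<le> \<eta> \<longrightarrow>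
        L \<le> exp \<beta> * exp (t\<^sup>2 * V / 2) * X + (1 - p) \<longrightarrow>
        exp (- \<beta>) * exp (t\<^sup>2 * V / 2) * X + (1 - p) \<le> L \<longrightarrow> \<bar>L - exp (t\<^sup>2 * V / 2)\<bar> \<le> \<delta>"
      by (intro eventually_ball_finite ballI laplace_tolerance T \<delta> exp_ge_zero)
    from eventually_happens'[OF trivial_limit_at_right_real eventually_conj[OF ev1 ev2]]
    obtain \<eta> where \<eta>: "0 < \<eta>" "\<eta> < 1 / 2" "\<eta> < e / 4"
      and tol: "\<And>t \<beta> X p L. t \<in> T \<Longrightarrow> \<beta> \<le> \<eta> \<Longrightarrow> \<bar>X - 1\<bar> \<le> \<eta> \<Longrightarrow> \<bar>p - 1\<bar> \<le> \<eta> \<Longrightarrow>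
        L \<le> exp \<beta> * exp (t\<^sup>2 * V / 2) * X + (1 - p) \<Longrightarrow>
        exp (- \<beta>) * exp (t\<^sup>2 * V / 2) * X + (1 - p) \<le> L \<Longrightarrow> \<bar>L - exp (t\<^sup>2 * V / 2)\<bar> \<le> \<delta>"
      unfolding min_less_iff_conj by blast
    have \<beta>_small: "\<forall>\<^sub>F n in sequentially. \<forall>t\<in>T. \<beta> t n \<le> \<eta>"
    proof (rule eventually_ball_finite[OF T], rule ballI)
      show "\<forall>\<^sub>F n in sequentially. \<beta> t n \<le> \<eta>" for t
        using order_tendstoD(2)[OF \<beta>_lim \<eta>(1), of t] by eventually_elim simp
    qed
    have T_small: "\<forall>\<^sub>F n in sequentially. \<forall>t\<in>T. \<bar>t\<bar> / s n * M \<le> 1 \<and> \<bar>t\<bar> / s n * \<kappa> t n \<le> 1 / 2"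
      using T small by (intro eventually_ball_finite) auto
    have "\<forall>\<^sub>F n in sequentially. \<forall>y\<in>space (sample_law f0 n). \<bar>p n y - 1\<bar> \<le> \<eta> \<longrightarrow>
        (\<forall>t\<in>T. \<bar>X t n y - 1\<bar> \<le> \<eta>) \<longrightarrow>
        \<bar>BL_dist (distr (frac_posterior (Pri n) (\<alpha> n) n y) borel (\<tau> n y)) (gaussian 0 V) - 0\<bar> \<le> e"
      using \<beta>_small T_small \<rho>_bound eventually_gt_at_top[of 0]
    proof eventually_elim
      fix n :: nat
      assume \<beta>: "\<forall>t\<in>T. \<beta> t n \<le> \<eta>" and T_small: "\<forall>t\<in>T. \<bar>t\<bar> / s n * M \<le> 1 \<and> \<bar>t\<bar> / s n * \<kappa> t n \<le> 1 / 2"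
        and \<rho>: "\<forall>f\<in>A n. s n * \<bar>r f f0\<bar> \<le> \<rho> n" and n: "0 < n"
      show "\<forall>y\<in>space (sample_law f0 n). \<bar>p n y - 1\<bar> \<le> \<eta> \<longrightarrow> (\<forall>t\<in>T. \<bar>X t n y - 1\<bar> \<le> \<eta>) \<longrightarrow>
        \<bar>BL_dist (distr (frac_posterior (Pri n) (\<alpha> n) n y) borel (\<tau> n y)) (gaussian 0 V) - 0\<bar> \<le> e"
      proof (intro ballI impI)
        fix y assume "y \<in> space (sample_law f0 n)" and p: "\<bar>p n y - 1\<bar> \<le> \<eta>"
          and X: "\<forall>t\<in>T. \<bar>X t n y - 1\<bar> \<le> \<eta>"
        then have y: "\<And>i. i < n \<Longrightarrow> y i \<in> {0..1}"
          by (blast intro: sample_law_in_unit_interval)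
        let ?P = "Pri n" and ?w = "frac_lik (\<alpha> n) n y" and ?\<tau>' = "\<lambda>f. indicator (A n) f * \<tau> n y f"
        let ?D = "\<integral>f. ?w f \<partial>?P"
        define Q where "Q = frac_posterior ?P (\<alpha> n) n y"
        have Q_eq: "Q = density ?P (\<lambda>f. ennreal (?w f / ?D))"
          by (simp add: Q_def frac_posterior_def)
        have \<alpha>: "0 < \<alpha> n"
          using alpha by blast
        have w [measurable]: "?w \<in> borel_measurable ?P"
          by (rule frac_lik_measurable[OF prior \<alpha> y])
        have A [measurable]: "A n \<in> sets ?P" and [measurable]: "\<psi> \<in> borel_measurable ?P"
          by (rule A_measurable, rule psi_measurable)
        have \<tau>_meas [measurable]: "\<tau> n y \<in> borel_measurable ?P"
          unfolding \<tau>_def by measurable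
        have dens: "prob_density01 f" if "f \<in> A n" for f
          using prior[of n] sets.sets_into_space[OF A] that by (auto simp: density_prior_def)
        have p_eq: "p n y = (LINT f:A n|?P. ?w f) / ?D"
          unfolding p_def by (rule measure_frac_posterior[OF w A])
        \<comment> \<open>Division by 0 gives 0, so a vanishing normaliser would make the posterior
          mass 0, too far from 1.\<close>
        have D: "?D \<noteq> 0"
          using p \<eta> by (auto simp: p_eq)
        interpret Q: prob_space Q
          unfolding Q_eq by (rule prob_space_density_normalized[OF w frac_lik_nonneg D])
        have [measurable_cong]: "sets Q = sets ?P"
          by (simp add: Q_eq)
        have tilt: "\<exists>b. \<bar>b\<bar> \<le> \<beta> t n \<and>
            frac_lik (\<alpha> n) n y (exp_tilt \<psi>t (t / s n) f) = ?w f * exp (t * \<tau> n y f - t\<^sup>2 * V / 2 + b)"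
          if t: "t \<in> T" and f: "f \<in> A n" for t f
        proof -
          have L1: "L1_dist f f0 \<le> \<epsilon> n" and q: "s n * \<bar>r f f0\<bar> \<le> \<rho> n"
            using f A_L1 \<rho> by auto
          have small': "\<bar>t\<bar> / s n * M \<le> 1" "\<bar>t\<bar> / s n * (M * \<epsilon> n + 2 * (\<bar>t\<bar> / s n) * M\<^sup>2) \<le> 1 / 2"
            using T_small t unfolding \<kappa>_def by blast+
          obtain b where
            b: "\<bar>b\<bar> \<le> \<beta> t n"
              "frac_lik (\<alpha> n) n y (exp_tilt \<psi>t (t / s n) f)
                = ?w f * exp (t * (s n * (\<psi> f - \<psi> f0 - 1 / real n * (\<Sum>i<n. \<psi>t (y i)))) - t\<^sup>2 * V / 2 + b)"
            unfolding \<beta>_def \<kappa>_def s_def V_def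
            by (rule frac_lik_tilt_expansion[OF n \<alpha> dens[OF f] f0 psit_measurable M centered L1
                  small'[unfolded s_def] y expansion[OF dens[OF f]] q[unfolded s_def]]) blast
          then show ?thesis
            by (intro exI[of _ b]) (simp add: \<tau>_def algebra_simps)
        qed
        have laplace: "integrable Q (\<lambda>f. exp (t * ?\<tau>' f)) \<and>
            \<bar>(\<integral>f. exp (t * ?\<tau>' f) \<partial>Q) - exp (t\<^sup>2 * V / 2)\<bar> \<le> \<delta>" if t: "t \<in> T" for t
        proof -
          let ?G = "exp (t\<^sup>2 * V / 2)" and ?w' = "\<lambda>f. frac_lik (\<alpha> n) n y (exp_tilt \<psi>t (t / s n) f)"
          have upper: "?w f * exp (t * \<tau> n y f) \<le> exp (\<beta> t n) * ?G * ?w' f"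
            and lower: "exp (- \<beta> t n) * ?G * ?w' f \<le> ?w f * exp (t * \<tau> n y f)" if "f \<in> A n" for f
          proof -
            obtain b where b: "\<bar>b\<bar> \<le> \<beta> t n" and eq: "?w' f = ?w f * exp (t * \<tau> n y f - t\<^sup>2 * V / 2 + b)"
              using tilt[OF t \<open>f \<in> A n\<close>] by blast
            \<comment> \<open>With \<open>a\<close> equal to plus or minus
              \<open>\<beta> t n\<close>, the sign of \<open>a + b\<close> is known, which gives the
              two one-sided bounds.\<close>
            have G: "exp a * ?G * ?w' f = (?w f * exp (t * \<tau> n y f)) * exp (a + b)" for a
              unfolding eq by (simp add: mult_exp_exp algebra_simps)
            have "?w f * exp (t * \<tau> n y f) * 1 \<le> ?w f * exp (t * \<tau> n y f) * exp (\<beta> t n + b)"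
              using b by (intro mult_left_mono) (simp_all add: frac_lik_nonneg)
            then show "?w f * exp (t * \<tau> n y f) \<le> exp (\<beta> t n) * ?G * ?w' f"
              unfolding G by simp
            show "exp (- \<beta> t n) * ?G * ?w' f \<le> ?w f * exp (t * \<tau> n y f)"
              unfolding G using b by (intro mult_right_le_one_le) (simp_all add: frac_lik_nonneg)
          qed
          have X0: "(LINT f:A n|?P. ?w' f) / ?D \<noteq> 0"
            using X t \<eta> by (force simp: X_def)
          note bounds = density_laplace_bounds[OF w frac_lik_nonneg D A \<tau>_meas upper lower X0,
              folded Q_eq p_eq]
          show ?thesis
            using bounds tol[OF t, of "\<beta> t n" "X t n y" "p n y"] \<beta> X p t by (simp add: X_def)
        qed
        have "real_distribution (distr Q borel ?\<tau>')"
          by (auto simp: real_distribution_def real_distribution_axioms_def intro!: Q.prob_space_distr)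
        then have trunc: "\<bar>(\<integral>x. h x \<partial>distr Q borel ?\<tau>') - (\<integral>x. h x \<partial>gaussian 0 V)\<bar> \<le> e / 2"
          if "h \<in> BL_functions" for h
          using laplace that by (intro close) (auto simp: integrable_distr_eq integral_distr)
        show "\<bar>BL_dist (distr (frac_posterior ?P (\<alpha> n) n y) borel (\<tau> n y)) (gaussian 0 V) - 0\<bar> \<le> e"
          unfolding Q_def[symmetric] diff_zero
        proof (rule BL_dist_le)
          fix h assume h: "h \<in> BL_functions"
          have triangle: "\<bar>a - c\<bar> \<le> u + v" if "\<bar>a - b\<bar> \<le> u" "\<bar>b - c\<bar> \<le> v" for a b c u v :: real
            using that by linarith
          have "\<bar>(\<integral>x. h x \<partial>distr Q borel (\<tau> n y)) - (\<integral>x. h x \<partial>distr Q borel ?\<tau>')\<bar> \<le> 2 * (1 - p n y)"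
            unfolding p_def Q_def[symmetric]
            by (rule BL_truncation[OF Q.prob_space_axioms _ _ h]) measurable
          from triangle[OF this trunc[OF h]]
          show "\<bar>(\<integral>x. h x \<partial>distr Q borel (\<tau> n y)) - (\<integral>x. h x \<partial>gaussian 0 V)\<bar> \<le> e"
            by (rule order_trans) (use p \<eta> in \<open>simp add: field_simps abs_le_iff\<close>)
        qed
      qed
    qed
    then show "\<exists>T \<eta>. finite T \<and> 0 < \<eta> \<and> (\<forall>\<^sub>F n in sequentially.
        \<forall>y\<in>space (sample_law f0 n). \<bar>p n y - 1\<bar> \<le> \<eta> \<longrightarrow> (\<forall>t\<in>T. \<bar>X t n y - 1\<bar> \<le> \<eta>) \<longrightarrow>
        \<bar>BL_dist (distr (frac_posterior (Pri n) (\<alpha> n) n y) borel (\<tau> n y)) (gaussian 0 V) - 0\<bar> \<le> e)"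
      using T \<eta>(1) by blast
  qed
  then show ?thesis
    unfolding weakly_in_prob_def \<tau>_def s_def V_def .
qed

end
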